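(* Let $F$ be a field of characteristic $2$ and let $n\ge 2$. Let $\beta,\gamma,\alpha_1,\dots,\alpha_{n-2}\in F^\times$ and $\alpha_{n-1}\in F$. The two (right-linked) quadratic $n$-fold Pfister forms $$\varphi=\langle\langle\beta,\alpha_1,\dots,\alpha_{n-1}]],\qquad \psi=\langle\langle\gamma,\alpha_1,\dots,\alpha_{n-1}]]$$ are left-linked if and only if the quadratic $(n+1)$-fold Pfister form $\pi=\langle\langle\gamma,\beta,\alpha_1,\dots,\alpha_{n-1}]]$ is hyperbolic.
   Context: $[a,b]$ denotes the quadratic form $ax^2+xy+by^2$. Bilinear Pfister forms: $\langle\langle\beta\rangle\rangle=\langle 1,\beta\rangle$ (diagonal symmetric bilinear form) and $\langle\langle\beta_1,\dots,\beta_m\rangle\rangle=\langle\langle\beta_1\rangle\rangle\otimes\cdots\otimes\langle\langle\beta_m\rangle\rangle$, $\beta_i\in F^\times$. Quadratic Pfister forms: $\langle\langle\alpha]]=[1,\alpha]$ and $\langle\langle\beta_1,\dots,\beta_{n-1},\alpha]]=\langle\langle\beta_1,\dots,\beta_{n-1}\rangle\rangle\otimes\langle\langle\alpha]]$ for $\beta_i\in F^\times$, $\alpha\in F$. A set of quadratic $n$-fold Pfister forms is left-linked if there is a bilinear $(n-1)$-fold Pfister form $b$ such that every form in the set is isometric to $b\otimes\langle\langle\alpha]]$ for some $\alpha\in F$. It is right-linked if there is a quadratic $(n-1)$-fold Pfister form $\rho$ such that every form in the set is isometric to $\langle\langle\beta\rangle\rangle\otimes\rho$ for some $\beta\in F^\times$.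 *)

theory Defs
  imports "Jordan_Normal_Form.Matrix"
begin

text \<open>
  A square matrix \<open>A\<close> of size \<open>d\<close> over a field \<open>F\<close> represents the quadratic form
  \<open>x \<mapsto> x\<^sup>T A x\<close> on \<open>F\<^sup>d\<close>, and a symmetric matrix \<open>B\<close> also represents the symmetric bilinear form
  \<open>(x, y) \<mapsto> x\<^sup>T B y\<close>. In characteristic 2 a quadratic form cannot in general be represented by a
  symmetric matrix, so \<open>A\<close> need not be symmetric. Different matrices may represent the same quadratic form; all notions for
  quadratic forms below depend only on the map \<open>x \<mapsto> x\<^sup>T A x\<close>.
\<close>

definition quad_eval :: "'a::comm_ring_1 mat \<Rightarrow> 'a vec \<Rightarrow> 'a" where
  "quad_eval A x = x \<bullet> (A *\<^sub>v x)"

definition isometric :: "'a::comm_ring_1 mat \<Rightarrow> 'a mat \<Rightarrow> bool" where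
  "isometric A B \<longleftrightarrow>
     (\<exists>d P. A \<in> carrier_mat d d \<and> B \<in> carrier_mat d d \<and> P \<in> carrier_mat d d \<and> invertible_mat P \<and>
        (\<forall>x \<in> carrier_vec d. quad_eval A (P *\<^sub>v x) = quad_eval B x))"

text \<open>The form \<open>[a, b]\<close>, i.e. \<open>a x\<^sup>2 + x y + b y\<^sup>2\<close>.\<close>

definition binary_form :: "'a::comm_ring_1 \<Rightarrow> 'a \<Rightarrow> 'a mat" where
  "binary_form a b = mat_of_rows_list 2 [[a, 1], [0, b]]"

text \<open>\<open>[0, 0]\<close> is the hyperbolic plane \<open>x y\<close>, and block diagonal sums are orthogonal sums.\<close>

definition hyperbolic :: "'a::comm_ring_1 mat \<Rightarrow> bool" where
  "hyperbolic A \<longleftrightarrow> (\<exists>m. isometric A (diag_block_mat (replicate m (binary_form 0 0))))"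

text \<open>
  The Kronecker product. For symmetric matrices it represents the tensor product of bilinear forms.
  If \<open>B\<close> is symmetric and \<open>A\<close> is any square matrix, \<open>tensor B A\<close> represents the tensor
  product \<open>b \<otimes> q\<close> of the bilinear form \<open>b\<close> of \<open>B\<close> with the quadratic form \<open>q\<close> of \<open>A\<close>: its value
  at \<open>v \<otimes> w\<close> is \<open>b(v, v) q(w)\<close>, and its polar form has the matrix
  \<open>tensor B (A + A\<^sup>T)\<close>, i.e. it is the tensor product of \<open>b\<close> with the polar form of \<open>q\<close>.
\<close>

definition tensor :: "'a::comm_ring_1 mat \<Rightarrow> 'a mat \<Rightarrow> 'a mat" where
  "tensor A B =
     mat (dim_row A * dim_row B) (dim_col A * dim_col B)
       (\<lambda>(i, j). A $$ (i div dim_row B, j div dim_col B) * B $$ (i mod dim_row B, j mod dim_col B))"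

definition bil_pfister1 :: "'a::comm_ring_1 \<Rightarrow> 'a mat" where
  "bil_pfister1 \<beta> = mat_of_rows_list 2 [[1, 0], [0, \<beta>]]"

text \<open>The empty tensor product is the form \<open>\<langle>1\<rangle>\<close>; \<open>tensor A (1\<^sub>m 1) = A\<close>.\<close>

definition bil_pfister :: "'a::comm_ring_1 list \<Rightarrow> 'a mat" where
  "bil_pfister \<beta>s = foldr (\<lambda>\<beta>. tensor (bil_pfister1 \<beta>)) \<beta>s (1\<^sub>m 1)"

text \<open>\<open>quad_pfister [\<beta>\<^sub>1, \<dots>, \<beta>\<^sub>m] \<alpha>\<close> is the \<open>(m+1)\<close>-fold form \<open>\<langle>\<langle>\<beta>\<^sub>1, \<dots>, \<beta>\<^sub>m, \<alpha>]]\<close>.\<close>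

definition quad_pfister :: "'a::comm_ring_1 list \<Rightarrow> 'a \<Rightarrow> 'a mat" where
  "quad_pfister \<beta>s \<alpha> = tensor (bil_pfister \<beta>s) (binary_form 1 \<alpha>)"

definition is_bil_pfister :: "nat \<Rightarrow> 'a::field mat \<Rightarrow> bool" where
  "is_bil_pfister m B \<longleftrightarrow> (\<exists>\<beta>s. length \<beta>s = m \<and> 0 \<notin> set \<beta>s \<and> B = bil_pfister \<beta>s)"

definition is_quad_pfister :: "nat \<Rightarrow> 'a::field mat \<Rightarrow> bool" where
  "is_quad_pfister m A \<longleftrightarrow> (\<exists>\<beta>s \<alpha>. Suc (length \<beta>s) = m \<and> 0 \<notin> set \<beta>s \<and> A = quad_pfister \<beta>s \<alpha>)"

text \<open>The following two notions are meant for sets \<open>S\<close> of quadratic \<open>n\<close>-fold Pfister forms.\<close>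

definition left_linked :: "nat \<Rightarrow> 'a::field mat set \<Rightarrow> bool" where
  "left_linked n S \<longleftrightarrow>
     (\<exists>B. is_bil_pfister (n - 1) B \<and> (\<forall>A\<in>S. \<exists>\<alpha>. isometric A (tensor B (binary_form 1 \<alpha>))))"

definition right_linked :: "nat \<Rightarrow> 'a::field mat set \<Rightarrow> bool" where
  "right_linked n S \<longleftrightarrow>
     (\<exists>R. is_quad_pfister (n - 1) R \<and> (\<forall>A\<in>S. \<exists>\<beta>. \<beta> \<noteq> 0 \<and> isometric A (tensor (bil_pfister1 \<beta>) R)))"

lemma dim_tensor [simp]:
  "dim_row (tensor A B) = dim_row A * dim_row B"
  "dim_col (tensor A B) = dim_col A * dim_col B"
  by (simp_all add: tensor_def)

lemma tensor_one: "tensor A (1\<^sub>m 1) = A"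
  by (rule eq_matI) (auto simp: tensor_def)

lemma tensor_index:
  "i < dim_row A * dim_row B \<Longrightarrow> j < dim_col A * dim_col B \<Longrightarrow>
     tensor A B $$ (i, j) =
       A $$ (i div dim_row B, j div dim_col B) * B $$ (i mod dim_row B, j mod dim_col B)"
  by (simp add: tensor_def)

lemma tensor_assoc: "tensor (tensor A B) C = tensor A (tensor B C)"
proof (rule eq_matI)
  fix i j
  assume "i < dim_row (tensor A (tensor B C))" "j < dim_col (tensor A (tensor B C))"
  hence i: "i < dim_row A * dim_row B * dim_row C" and j: "j < dim_col A * dim_col B * dim_col C"
    by (simp_all add: mult.assoc)
  have pos: "0 < dim_row B * dim_row C" "0 < dim_col B * dim_col C"
    using i j by (auto intro: Nat.gr0I)
  have div_less: "i div dim_row C < dim_row A * dim_row B" "j div dim_col C < dim_col A * dim_col B"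
    using i j by (simp_all add: less_mult_imp_div_less)
  have div_mod: "k mod (b * c) div c = k div c mod b" for k b c :: nat
    by (cases "c = 0") (simp_all add: mult.commute[of b c] mod_mult2_eq)
  have div_div: "k div (b * c) = k div c div b" for k b c :: nat
    by (subst mult.commute) (rule div_mult2_eq)
  have mod_mod: "k mod (b * c) mod c = k mod c" for k b c :: nat
    by (simp add: mod_mod_cancel)
  have mod_less: "i mod (dim_row B * dim_row C) < dim_row B * dim_row C"
    "j mod (dim_col B * dim_col C) < dim_col B * dim_col C"
    using pos by (simp_all only: mod_less_divisor)
  have "tensor (tensor A B) C $$ (i, j) =
      tensor A B $$ (i div dim_row C, j div dim_col C) * C $$ (i mod dim_row C, j mod dim_col C)"
    using i j by (intro tensor_index) simp_all
  also have "\<dots> = A $$ (i div dim_row C div dim_row B, j div dim_col C div dim_col B) *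
      (B $$ (i div dim_row C mod dim_row B, j div dim_col C mod dim_col B) *
       C $$ (i mod dim_row C, j mod dim_col C))"
    by (simp only: tensor_index[OF div_less] mult.assoc)
  also have "\<dots> = A $$ (i div (dim_row B * dim_row C), j div (dim_col B * dim_col C)) *
      tensor B C $$ (i mod (dim_row B * dim_row C), j mod (dim_col B * dim_col C))"
    by (simp only: tensor_index[OF mod_less] div_mod div_div mod_mod)
  also have "\<dots> = tensor A (tensor B C) $$ (i, j)"
    using tensor_index[of i A "tensor B C" j] i j by (simp add: mult.assoc)
  finally show "tensor (tensor A B) C $$ (i, j) = tensor A (tensor B C) $$ (i, j)" .
qed (simp_all add: mult.assoc)

lemma quad_pfister_Cons: "quad_pfister (\<beta> # \<beta>s) \<alpha> = tensor (bil_pfister1 \<beta>) (quad_pfister \<beta>s \<alpha>)"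
  by (simp add: quad_pfister_def bil_pfister_def tensor_assoc)

lemma isometric_refl:
  assumes "A \<in> carrier_mat d d"
  shows "isometric A A"
proof -
  have "invertible_mat (1\<^sub>m d :: 'a mat)"
    unfolding invertible_mat_def inverts_mat_def by (intro conjI exI[of _ "1\<^sub>m d"]) simp_all
  thus ?thesis
    unfolding isometric_def using assms by (intro exI[of _ d] exI[of _ "1\<^sub>m d"]) simp
qed

lemma quad_pfister_carrier:
  "quad_pfister \<beta>s \<alpha> \<in> carrier_mat (2 ^ Suc (length \<beta>s)) (2 ^ Suc (length \<beta>s))"
proof (induction \<beta>s)
  case Nil
  show ?case
    by (intro carrier_matI)
      (simp_all add: quad_pfister_def bil_pfister_def binary_form_def mat_of_rows_list_def)
next
  case (Cons \<beta> \<beta>s)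
  from Cons[THEN carrier_matD(1)] Cons[THEN carrier_matD(2)] show ?case
    by (intro carrier_matI) (simp_all add: quad_pfister_Cons bil_pfister1_def mat_of_rows_list_def)
qed

lemma right_linked_quad_pfister:
  assumes "\<beta> \<noteq> 0" "\<gamma> \<noteq> 0" "0 \<notin> set \<alpha>s" "n = length \<alpha>s + 2"
  shows "right_linked n {quad_pfister (\<beta> # \<alpha>s) \<alpha>, quad_pfister (\<gamma> # \<alpha>s) \<alpha>}"
  unfolding right_linked_def
proof (intro exI[of _ "quad_pfister \<alpha>s \<alpha>"] conjI ballI)
  show "is_quad_pfister (n - 1) (quad_pfister \<alpha>s \<alpha>)"
    using assms by (auto simp: is_quad_pfister_def)
next
  fix A assume "A \<in> {quad_pfister (\<beta> # \<alpha>s) \<alpha>, quad_pfister (\<gamma> # \<alpha>s) \<alpha>}"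
  then obtain \<delta> where "\<delta> \<noteq> 0" "A = quad_pfister (\<delta> # \<alpha>s) \<alpha>"
    using assms by auto
  thus "\<exists>\<delta>. \<delta> \<noteq> 0 \<and> isometric A (tensor (bil_pfister1 \<delta>) (quad_pfister \<alpha>s \<alpha>))"
    using isometric_refl[OF quad_pfister_carrier, of "\<delta> # \<alpha>s" \<alpha>]
    by (auto simp: quad_pfister_Cons)
qed

end

(*
  Let \<rho> be the (n-1)-fold form common to \<phi> = \<rho> \<bottom> \<beta>\<rho> and \<psi> = \<rho> \<bottom> \<gamma>\<rho>. Both properties are
  equivalent to the isotropy of \<langle>1\<rangle> \<bottom> \<beta>\<rho> \<bottom> \<gamma>\<rho>, i.e. to a nontrivial relation
  t^2 = \<beta>\<rho>(y) + \<gamma>\<rho>(z). This form is a subform of \<pi> of more than half its dimension, so the relation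
  exists if \<pi> is hyperbolic; conversely it makes \<pi> isotropic, hence hyperbolic.
  If \<rho> is anisotropic and t = 1, then \<delta> = \<beta>\<rho>(y) satisfies \<phi> \<cong> \<langle>\<langle>\<delta>\<rangle>\<rangle>\<rho> and \<psi> \<cong> \<langle>\<langle>1 + \<delta>\<rangle>\<rangle>\<rho> by
  roundness, and \<langle>\<langle>1 + \<delta>, \<alpha>]] \<cong> \<langle>\<langle>\<delta>, \<alpha>']] gives the left linkage.
  If \<phi> = b \<otimes> [1, a] and \<psi> = b \<otimes> [1, a'], then the totally singular subform b \<otimes> \<langle>1\<rangle> of both is compared
  with the common subform \<rho>, and a dimension count produces a relation.
*)
theory Submission
  imports Defs "Jordan_Normal_Form.Determinant"
begin

subsection \<open>Linear systems\<close>

text \<open>The two dimension counts are of different depth. If \<pi> is hyperbolic, half as many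
  equations as dim \<pi> are imposed on a subspace with one dimension more, and any nonzero solution
  is a nontrivial relation. For linked forms this is not enough: with N = dim \<rho> = dim b,
  comparing components in \<rho> gives N equations in N + 1 unknowns, but a nonzero solution may
  yield only the trivial relation, namely when a vector of b \<otimes> \<langle>1\<rangle> lies in
  the summand \<rho> of both decompositions. Dimension does not exclude such vectors; polarity does.
  As b \<otimes> \<langle>1\<rangle> is totally singular, they are orthogonal to its components in
  \<rho> under both decompositions, hence to the image of the system. This is the situation of
  \<open>kernel_pairing\<close>, and nondegeneracy of the polar form of \<rho> ends the argument.
  The extra unknown t comes from a vector e_0 with b(e_0, e_0) = 1: in characteristic 2 the map v
  \<mapsto> b(v, v) is additive, so replacing v by v + t e_0 adds t^2.\<close>

lemma mult_mat_unit_vec: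
  fixes A :: "'a::comm_ring_1 mat"
  assumes "A \<in> carrier_mat n m" "j < m"
  shows "A *\<^sub>v unit_vec m j = col A j"
  using assms by (intro eq_vecI) auto

lemma linear_map_matrix:
  fixes f :: "'a::field vec \<Rightarrow> 'a vec"
  assumes carrier: "\<And>x. x \<in> carrier_vec m \<Longrightarrow> f x \<in> carrier_vec n"
    and add: "\<And>x y. x \<in> carrier_vec m \<Longrightarrow> y \<in> carrier_vec m \<Longrightarrow> f (x + y) = f x + f y"
    and smult: "\<And>c x. x \<in> carrier_vec m \<Longrightarrow> f (c \<cdot>\<^sub>v x) = c \<cdot>\<^sub>v f x"
  obtains A where "A \<in> carrier_mat n m" "\<And>x. x \<in> carrier_vec m \<Longrightarrow> f x = A *\<^sub>v x"
proof
  define A where "A = mat n m (\<lambda>(i, j). f (unit_vec m j) $ i)"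
  show A: "A \<in> carrier_mat n m" by (simp add: A_def)
  have unit: "f (unit_vec m j) = A *\<^sub>v unit_vec m j" if "j < m" for j
    using that carrier[of "unit_vec m j"] A
    by (intro eq_vecI) (auto simp: A_def)
  \<comment> \<open>Induction on the length k of the initial segment that may carry nonzero entries;
    each step splits off one unit vector.\<close>
  have supp: "f x = A *\<^sub>v x"
    if "k \<le> m" "x \<in> carrier_vec m" "\<And>i. k \<le> i \<Longrightarrow> i < m \<Longrightarrow> x $ i = 0" for k x
    using that
  proof (induction k arbitrary: x)
    case 0
    then have x: "x = 0\<^sub>v m" by (intro eq_vecI) auto
    have "0 \<cdot>\<^sub>v x = x" using x by (intro eq_vecI) auto
    then have "f x = 0 \<cdot>\<^sub>v f x" using smult[of x 0] 0 by simp
    moreover have "0 \<cdot>\<^sub>v f x = 0\<^sub>v n" using carrier[of x] 0 by (intro eq_vecI) auto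
    ultimately show ?case using A x by auto
  next
    case (Suc k)
    define y where "y = vec m (\<lambda>i. if i = k then 0 else x $ i)"
    have y: "y \<in> carrier_vec m" by (simp add: y_def)
    have x: "x = y + x $ k \<cdot>\<^sub>v unit_vec m k"
      using Suc.prems by (intro eq_vecI) (auto simp: y_def unit_vec_def)
    have IH: "f y = A *\<^sub>v y"
      using Suc.prems y by (intro Suc.IH) (auto simp: y_def)
    have "f x = f y + x $ k \<cdot>\<^sub>v f (unit_vec m k)"
      by (subst x) (use y in \<open>simp add: add smult\<close>)
    also have "\<dots> = A *\<^sub>v (y + x $ k \<cdot>\<^sub>v unit_vec m k)"
      using Suc.prems IH unit[of k] y A by (simp add: mult_add_distrib_mat_vec[OF A] mult_mat_vec[OF A])
    finally show ?case using x by simp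
  qed
  then show "f x = A *\<^sub>v x" if "x \<in> carrier_vec m" for x
    using that by (intro supp[of m]) auto
qed

text \<open>Padding with zero rows makes the matrix square. Its last row is zero, so the transpose
  kills the last unit vector and the determinant vanishes.\<close>

lemma underdetermined_system:
  fixes A :: "'a::field mat"
  assumes A: "A \<in> carrier_mat n m" and "n < m"
  obtains v where "v \<in> carrier_vec m" "v \<noteq> 0\<^sub>v m" "A *\<^sub>v v = 0\<^sub>v n"
proof -
  define B where "B = mat m m (\<lambda>(i, j). if i < n then A $$ (i, j) else 0)"
  have B: "B \<in> carrier_mat m m" by (simp add: B_def)
  have "B\<^sup>T *\<^sub>v unit_vec m (m - 1) = 0\<^sub>v m"
    using assms by (intro eq_vecI) (auto simp: B_def)
  moreover have "unit_vec m (m - 1) \<noteq> (0\<^sub>v m :: 'a vec)"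
    using assms by (metis diff_less index_unit_vec(2) index_zero_vec(1) less_nat_zero_code
      linorder_neqE_nat zero_less_one zero_neq_one)
  ultimately have "det B\<^sup>T = 0"
    using B by (subst det_0_iff_vec_prod_zero[of _ m]) (auto intro!: exI[of _ "unit_vec m (m - 1)"])
  then have "det B = 0" using det_transpose[OF B] by simp
  then obtain v where v: "v \<in> carrier_vec m" "v \<noteq> 0\<^sub>v m" "B *\<^sub>v v = 0\<^sub>v m"
    using det_0_iff_vec_prod_zero[OF B] by auto
  have "(A *\<^sub>v v) $ i = (B *\<^sub>v v) $ i" if "i < n" for i
    using that assms v(1) by (auto simp: B_def scalar_prod_def intro!: sum.cong)
  then have "A *\<^sub>v v = 0\<^sub>v n"
    using v assms by (intro eq_vecI) auto
  with v show thesis by (intro that)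
qed

text \<open>
  If \<open>T\<close> maps the kernel of \<open>S\<close> into the left kernel of \<open>S\<close>, then it is not injective there, because
  the right kernel has the larger dimension. After row reduction of \<open>S\<close>, the equations for the
  kernel of \<open>S\<close> occupy the pivot rows, and those for \<open>T w = 0\<close> the remaining ones.
\<close>

lemma kernel_pairing:
  fixes S T :: "'a::field mat"
  assumes S: "S \<in> carrier_mat n m" and T: "T \<in> carrier_mat n m" and "n < m"
    and ker: "\<And>w w'. w \<in> carrier_vec m \<Longrightarrow> w' \<in> carrier_vec m \<Longrightarrow> S *\<^sub>v w = 0\<^sub>v n \<Longrightarrow>
      (T *\<^sub>v w) \<bullet> (S *\<^sub>v w') = 0"
  obtains w where "w \<in> carrier_vec m" "w \<noteq> 0\<^sub>v m" "S *\<^sub>v w = 0\<^sub>v n" "T *\<^sub>v w = 0\<^sub>v n"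
proof -
  obtain C P' where gj: "gauss_jordan S (1\<^sub>m n) = (C, P')" by (cases "gauss_jordan S (1\<^sub>m n)")
  from gauss_jordan_transform[OF S one_carrier_mat gj, where b = "()"] obtain P
    where "P \<in> Units (ring_mat TYPE('a) n ())" and C_eq: "C = P * S" by auto
  then obtain Q where P: "P \<in> carrier_mat n n" and Q: "Q \<in> carrier_mat n n"
    and PQ: "P * Q = 1\<^sub>m n" "Q * P = 1\<^sub>m n"
    by (auto simp: Units_def ring_mat_simps)
  have C: "C \<in> carrier_mat n m" using C_eq P S by simp
  have S_eq: "S = Q * C"
    using assoc_mult_mat[OF Q P S] S by (simp add: C_eq PQ)
  from gauss_jordan_row_echelon[OF S gj] obtain f where f: "pivot_fun C f m"
    using C by (auto simp: row_echelon_form_def)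
  note piv = pivot_funD[OF carrier_matD(1)[OF C] f]
  \<comment> \<open>Since S = Q C, pairing T w with S w' is pairing R w with C w': R is T in the
    dual basis.\<close>
  define R where "R = Q\<^sup>T * T"
  have R: "R \<in> carrier_mat n m" using Q T by (simp add: R_def)
  define D where "D = mat n m (\<lambda>(i, j). if f i < m then C $$ (i, j) else R $$ (i, j))"
  have D: "D \<in> carrier_mat n m" by (simp add: D_def)
  from underdetermined_system[OF D \<open>n < m\<close>] obtain w
    where w: "w \<in> carrier_vec m" "w \<noteq> 0\<^sub>v m" "D *\<^sub>v w = 0\<^sub>v n" .
  have Dw: "(D *\<^sub>v w) $ i = (if f i < m then (C *\<^sub>v w) $ i else (R *\<^sub>v w) $ i)" if "i < n" for i
    using that w(1) C R by (auto simp: D_def scalar_prod_def intro!: sum.cong)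
  have "(C *\<^sub>v w) $ i = 0" if i: "i < n" for i
  proof (cases "f i < m")
    case True
    then show ?thesis using Dw[OF i] w i by simp
  next
    case False
    then have "C $$ (i, j) = 0" if "j < m" for j using piv(2)[OF i, of j] that by simp
    then show ?thesis using C i w by (auto simp: scalar_prod_def)
  qed
  then have "C *\<^sub>v w = 0\<^sub>v n" using C by (intro eq_vecI) auto
  then have Sw: "S *\<^sub>v w = 0\<^sub>v n"
    using Q C w by (auto simp: S_eq assoc_mult_mat_vec[of _ n n _ m])
  have Rw: "(R *\<^sub>v w) = Q\<^sup>T *\<^sub>v (T *\<^sub>v w)"
    using Q T w by (simp add: R_def assoc_mult_mat_vec[of _ n n _ m])
  \<comment> \<open>In a pivot row this entry pairs T w with column i of Q, which is the image under
    S of a unit vector, so it vanishes by \<open>ker\<close>. Only the other rows need an equation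
    from D.\<close>
  have "(R *\<^sub>v w) $ i = 0" if i: "i < n" for i
  proof (cases "f i < m")
    case True
    have col: "col C (f i) = unit_vec n i"
      using piv(4)[OF i True] piv(5)[OF i True] C True i by (intro eq_vecI) auto
    have "S *\<^sub>v unit_vec m (f i) = Q *\<^sub>v (C *\<^sub>v unit_vec m (f i))"
      using Q C by (simp add: S_eq assoc_mult_mat_vec[of _ n n _ m])
    also have "C *\<^sub>v unit_vec m (f i) = unit_vec n i"
      using mult_mat_unit_vec[OF C True] col by simp
    also have "Q *\<^sub>v unit_vec n i = col Q i" using mult_mat_unit_vec[OF Q i] .
    finally have "(T *\<^sub>v w) \<bullet> col Q i = 0"
      using ker[OF w(1) _ Sw, of "unit_vec m (f i)"] by simp
    then show ?thesis
      using Rw Q T w i by (simp add: comm_scalar_prod[of _ n])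
  next
    case False
    then show ?thesis using Dw[OF i] w i by simp
  qed
  then have "Q\<^sup>T *\<^sub>v (T *\<^sub>v w) = 0\<^sub>v n" using Rw Q by (intro eq_vecI) auto
  then have "P\<^sup>T *\<^sub>v (Q\<^sup>T *\<^sub>v (T *\<^sub>v w)) = 0\<^sub>v n" using P by auto
  moreover have "P\<^sup>T * Q\<^sup>T = 1\<^sub>m n"
    using transpose_mult[OF Q P] PQ by simp
  ultimately have "T *\<^sub>v w = 0\<^sub>v n"
    using P Q T w assoc_mult_mat_vec[of "P\<^sup>T" n n "Q\<^sup>T" n "T *\<^sub>v w"] by simp
  with w Sw show thesis by (intro that)
qed

subsection \<open>Isometries and orthogonal sums\<close>

lemma char2_add_self:
  fixes x :: "'a::field"
  assumes "CHAR('a) = 2"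
  shows "x + x = 0"
proof -
  have "(2 :: 'a) = 0" using of_nat_CHAR[where 'a = 'a] assms by simp
  then show ?thesis by (metis mult_2 mult_zero_left)
qed

lemma char2_mult_2:
  fixes x :: "'a::field"
  assumes "CHAR('a) = 2"
  shows "2 * x = 0"
  unfolding mult_2 by (rule char2_add_self[OF assms])

lemma char2_uminus:
  fixes x :: "'a::field"
  assumes "CHAR('a) = 2"
  shows "- x = x"
  using char2_add_self[OF assms, of x] by (simp add: eq_neg_iff_add_eq_0 minus_equation_iff)

lemma char2_minus:
  fixes x y :: "'a::field"
  assumes "CHAR('a) = 2"
  shows "x - y = x + y"
  using char2_uminus[OF assms, of y] by (metis diff_conv_add_uminus)

lemma mult_mat_zero_vec: "A \<in> carrier_mat n m \<Longrightarrow> A *\<^sub>v 0\<^sub>v m = (0\<^sub>v n :: 'a::comm_ring_1 vec)"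
  by (intro eq_vecI) auto

lemma zero_mult_mat_vec: "x \<in> carrier_vec m \<Longrightarrow> 0\<^sub>m n m *\<^sub>v x = (0\<^sub>v n :: 'a::comm_ring_1 vec)"
  by (intro eq_vecI) auto

section \<open>Values and polar forms\<close>

definition polar :: "'a::comm_ring_1 mat \<Rightarrow> 'a vec \<Rightarrow> 'a vec \<Rightarrow> 'a" where
  "polar A x y = x \<bullet> (A *\<^sub>v y) + y \<bullet> (A *\<^sub>v x)"

lemma quad_eval_add:
  assumes "A \<in> carrier_mat d d" "x \<in> carrier_vec d" "y \<in> carrier_vec d"
  shows "quad_eval A (x + y) = quad_eval A x + quad_eval A y + polar A x y"
  using assms
  by (simp add: quad_eval_def polar_def mult_add_distrib_mat_vec[of A d d]
      add_scalar_prod_distrib[of _ d] scalar_prod_add_distrib[of _ d])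

lemma quad_eval_smult_vec:
  fixes A :: "'a::field mat"
  assumes "A \<in> carrier_mat d d" "x \<in> carrier_vec d"
  shows "quad_eval A (c \<cdot>\<^sub>v x) = c\<^sup>2 * quad_eval A x"
  using assms by (simp add: quad_eval_def mult_mat_vec[of A d d] power2_eq_square)

lemma quad_eval_zero:
  assumes "A \<in> carrier_mat d d"
  shows "quad_eval A (0\<^sub>v d) = 0"
  using assms by (simp add: quad_eval_def mult_mat_zero_vec)

lemma quad_eval_smult_mat:
  assumes "A \<in> carrier_mat d d" "x \<in> carrier_vec d"
  shows "quad_eval (c \<cdot>\<^sub>m A) x = c * quad_eval A x"
proof -
  have "(c \<cdot>\<^sub>m A) *\<^sub>v x = c \<cdot>\<^sub>v (A *\<^sub>v x)"
    using assms by (intro eq_vecI) auto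
  then show ?thesis using assms by (simp add: quad_eval_def)
qed

lemma polar_smult_left:
  fixes A :: "'a::field mat"
  assumes "A \<in> carrier_mat d d" "x \<in> carrier_vec d" "y \<in> carrier_vec d"
  shows "polar A (c \<cdot>\<^sub>v x) y = c * polar A x y"
  using assms by (simp add: polar_def mult_mat_vec[of A d d] algebra_simps)

lemma polar_commute: "polar A x y = polar A y x"
  by (simp add: polar_def add.commute)

lemma polar_zero:
  assumes "A \<in> carrier_mat d d" "x \<in> carrier_vec d"
  shows "polar A x (0\<^sub>v d) = 0" "polar A (0\<^sub>v d) x = 0"
  using assms by (simp_all add: polar_def mult_mat_zero_vec)

section \<open>Isometries\<close>

lemma isometricI:
  fixes A B :: "'a::field mat"
  assumes "A \<in> carrier_mat d d" "B \<in> carrier_mat d d" "P \<in> carrier_mat d d" "P' \<in> carrier_mat d d"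
    and "P * P' = 1\<^sub>m d"
    and "\<And>x. x \<in> carrier_vec d \<Longrightarrow> quad_eval A (P *\<^sub>v x) = quad_eval B x"
  shows "isometric A B"
proof -
  have "P' * P = 1\<^sub>m d" using assms by (intro mat_mult_left_right_inverse[of P]) auto
  then have "invertible_mat P"
    unfolding invertible_mat_def inverts_mat_def using assms by (intro conjI exI[of _ P']) auto
  then show ?thesis unfolding isometric_def using assms by blast
qed

lemma isometricE:
  fixes A B :: "'a::field mat"
  assumes "isometric A B" "A \<in> carrier_mat d d"
  obtains P P' where "B \<in> carrier_mat d d" "P \<in> carrier_mat d d" "P' \<in> carrier_mat d d"
    "P * P' = 1\<^sub>m d" "P' * P = 1\<^sub>m d"
    "\<And>x. x \<in> carrier_vec d \<Longrightarrow> quad_eval A (P *\<^sub>v x) = quad_eval B x"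
    "\<And>x. x \<in> carrier_vec d \<Longrightarrow> quad_eval B (P' *\<^sub>v x) = quad_eval A x"
proof -
  from assms obtain P where B: "B \<in> carrier_mat d d" and P: "P \<in> carrier_mat d d"
    and inv: "invertible_mat P"
    and eval: "\<And>x. x \<in> carrier_vec d \<Longrightarrow> quad_eval A (P *\<^sub>v x) = quad_eval B x"
    unfolding isometric_def by auto
  from inv obtain P' where inv: "P * P' = 1\<^sub>m (dim_row P)" "P' * P = 1\<^sub>m (dim_row P')"
    unfolding invertible_mat_def inverts_mat_def by auto
  have "dim_col P' = d" using arg_cong[OF inv(1), of dim_col] P by simp
  moreover have "dim_row P' = d" using arg_cong[OF inv(2), of dim_col] P by simp
  ultimately have P': "P' \<in> carrier_mat d d" by auto
  have "quad_eval B (P' *\<^sub>v x) = quad_eval A x" if x: "x \<in> carrier_vec d" for x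
  proof -
    have "P *\<^sub>v (P' *\<^sub>v x) = x"
      using inv(1) P P' x assoc_mult_mat_vec[of P d d P' d x] by simp
    then show ?thesis using eval[of "P' *\<^sub>v x"] P' x by simp
  qed
  with B P P' inv eval show thesis by (intro that[of P P']) (auto simp: \<open>dim_row P' = d\<close>)
qed

lemma isometric_sym:
  fixes A B :: "'a::field mat"
  assumes "isometric A B"
  shows "isometric B A"
proof -
  from assms obtain d where A: "A \<in> carrier_mat d d" unfolding isometric_def by auto
  from isometricE[OF assms A] obtain P P' where "B \<in> carrier_mat d d" "P \<in> carrier_mat d d"
    "P' \<in> carrier_mat d d" "P' * P = 1\<^sub>m d"
    "\<And>x. x \<in> carrier_vec d \<Longrightarrow> quad_eval B (P' *\<^sub>v x) = quad_eval A x" by metis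
  with A show ?thesis by (intro isometricI[of _ d _ P' P])
qed

lemma isometric_trans [trans]:
  fixes A B C :: "'a::field mat"
  assumes "isometric A B" "isometric B C"
  shows "isometric A C"
proof -
  from assms obtain d where A: "A \<in> carrier_mat d d" unfolding isometric_def by auto
  from isometricE[OF assms(1) A] obtain P P' where B: "B \<in> carrier_mat d d"
    and P: "P \<in> carrier_mat d d" "P' \<in> carrier_mat d d" "P * P' = 1\<^sub>m d"
    "\<And>x. x \<in> carrier_vec d \<Longrightarrow> quad_eval A (P *\<^sub>v x) = quad_eval B x" by metis
  from isometricE[OF assms(2) B] obtain Q Q' where C: "C \<in> carrier_mat d d"
    and Q: "Q \<in> carrier_mat d d" "Q' \<in> carrier_mat d d" "Q * Q' = 1\<^sub>m d"
    "\<And>x. x \<in> carrier_vec d \<Longrightarrow> quad_eval B (Q *\<^sub>v x) = quad_eval C x" by metis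
  have "P * Q * (Q' * P') = P * (Q * Q') * P'"
    using P(1,2) Q(1,2) by (simp add: assoc_mult_mat[of _ d d _ d _ d])
  then have "P * Q * (Q' * P') = 1\<^sub>m d" using P Q by simp
  then show ?thesis
    using A C P Q
    by (intro isometricI[of _ d _ "P * Q" "Q' * P'"]) (auto simp: assoc_mult_mat_vec[of _ d d _ d])
qed

lemma isometric_smult:
  fixes A B :: "'a::field mat"
  assumes "isometric A B"
  shows "isometric (c \<cdot>\<^sub>m A) (c \<cdot>\<^sub>m B)"
proof -
  from assms obtain d where A: "A \<in> carrier_mat d d" unfolding isometric_def by auto
  from isometricE[OF assms A] obtain P P' where "B \<in> carrier_mat d d"
    "P \<in> carrier_mat d d" "P' \<in> carrier_mat d d" "P * P' = 1\<^sub>m d"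
    "\<And>x. x \<in> carrier_vec d \<Longrightarrow> quad_eval A (P *\<^sub>v x) = quad_eval B x" by metis
  with A show ?thesis
    by (intro isometricI[of _ d _ P P']) (auto simp: quad_eval_smult_mat[of _ d])
qed

lemma isometric_square:
  fixes A :: "'a::field mat"
  assumes A: "A \<in> carrier_mat d d" and "c \<noteq> 0"
  shows "isometric (c\<^sup>2 \<cdot>\<^sub>m A) A"
proof (rule isometricI)
  show "(1 / c) \<cdot>\<^sub>m 1\<^sub>m d * (c \<cdot>\<^sub>m 1\<^sub>m d) = 1\<^sub>m d"
    using assms by (intro eq_matI) auto
  fix x :: "'a vec" assume x: "x \<in> carrier_vec d"
  have "((1 / c) \<cdot>\<^sub>m 1\<^sub>m d) *\<^sub>v x = (1 / c) \<cdot>\<^sub>v x"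
    using x by (intro eq_vecI) auto
  then show "quad_eval (c\<^sup>2 \<cdot>\<^sub>m A) (((1 / c) \<cdot>\<^sub>m 1\<^sub>m d) *\<^sub>v x) = quad_eval A x"
    using assms x by (simp add: quad_eval_smult_mat[of _ d] quad_eval_smult_vec[of _ d] power_divide)
qed (use assms in auto)

section \<open>Orthogonal sums\<close>

definition osum :: "'a::zero mat \<Rightarrow> 'a mat \<Rightarrow> 'a mat" where
  "osum A B = four_block_mat A (0\<^sub>m (dim_row A) (dim_col B)) (0\<^sub>m (dim_row B) (dim_col A)) B"

lemma osum_carrier [simp]:
  "A \<in> carrier_mat a a \<Longrightarrow> B \<in> carrier_mat b b \<Longrightarrow> osum A B \<in> carrier_mat (a + b) (a + b)"
  by (auto simp: osum_def)

lemma osum_assoc: "osum (osum A B) C = osum A (osum B C)"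
  unfolding osum_def by (rule assoc_four_block_mat[symmetric])

lemma osum_smult: "c \<cdot>\<^sub>m osum A B = osum (c \<cdot>\<^sub>m A) (c \<cdot>\<^sub>m (B :: 'a::comm_ring_1 mat))"
  unfolding osum_def by (intro eq_matI) auto

lemma quad_eval_osum:
  assumes "A \<in> carrier_mat a a" "B \<in> carrier_mat b b" "x \<in> carrier_vec a" "y \<in> carrier_vec b"
  shows "quad_eval (osum A B) (x @\<^sub>v y) = quad_eval A x + quad_eval B y"
  using assms
  by (simp add: quad_eval_def osum_def four_block_mat_mult_vec[of A a a _ b _ b]
      zero_mult_mat_vec scalar_prod_append[of _ a _ b])

lemma polar_osum:
  assumes "A \<in> carrier_mat a a" "B \<in> carrier_mat b b" "x \<in> carrier_vec a" "y \<in> carrier_vec b"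
    "x' \<in> carrier_vec a" "y' \<in> carrier_vec b"
  shows "polar (osum A B) (x @\<^sub>v y) (x' @\<^sub>v y') = polar A x x' + polar B y y'"
  using assms
  by (simp add: polar_def osum_def four_block_mat_mult_vec[of A a a _ b _ b]
      zero_mult_mat_vec scalar_prod_append[of _ a _ b])

lemma isometric_osum:
  fixes A B :: "'a::field mat"
  assumes "isometric A A'" "isometric B B'"
  shows "isometric (osum A B) (osum A' B')"
proof -
  from assms obtain a b where A: "A \<in> carrier_mat a a" and B: "B \<in> carrier_mat b b"
    unfolding isometric_def by auto
  from isometricE[OF assms(1) A] obtain P P' where A': "A' \<in> carrier_mat a a"
    and P: "P \<in> carrier_mat a a" "P' \<in> carrier_mat a a" "P * P' = 1\<^sub>m a"
    and evP: "\<And>x. x \<in> carrier_vec a \<Longrightarrow> quad_eval A (P *\<^sub>v x) = quad_eval A' x" by metis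
  from isometricE[OF assms(2) B] obtain Q Q' where B': "B' \<in> carrier_mat b b"
    and Q: "Q \<in> carrier_mat b b" "Q' \<in> carrier_mat b b" "Q * Q' = 1\<^sub>m b"
    and evQ: "\<And>x. x \<in> carrier_vec b \<Longrightarrow> quad_eval B (Q *\<^sub>v x) = quad_eval B' x" by metis
  show ?thesis
  proof (rule isometricI)
    show "osum A B \<in> carrier_mat (a + b) (a + b)" "osum A' B' \<in> carrier_mat (a + b) (a + b)"
      "osum P Q \<in> carrier_mat (a + b) (a + b)" "osum P' Q' \<in> carrier_mat (a + b) (a + b)"
      using A B A' B' P Q by auto
    show "osum P Q * osum P' Q' = 1\<^sub>m (a + b)"
      unfolding osum_def using P Q
      by (subst mult_four_block_mat[of _ a a _ b _ b _ _ a _ b]) (auto simp: four_block_one_mat)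
    fix x :: "'a vec" assume x: "x \<in> carrier_vec (a + b)"
    define y z where "y = vec_first x a" and "z = vec_last x b"
    have yz: "x = y @\<^sub>v z" "y \<in> carrier_vec a" "z \<in> carrier_vec b"
      using x by (auto simp: y_def z_def)
    have "osum P Q *\<^sub>v x = (P *\<^sub>v y) @\<^sub>v (Q *\<^sub>v z)"
      using yz P Q by (simp add: osum_def four_block_mat_mult_vec[of P a a _ b _ b] zero_mult_mat_vec)
    then show "quad_eval (osum A B) (osum P Q *\<^sub>v x) = quad_eval (osum A' B') x"
      using yz A B A' B' P Q by (simp add: quad_eval_osum[of _ a _ b] evP evQ)
  qed
qed

lemma isometric_osum_commute:
  fixes A B :: "'a::field mat"
  assumes A: "A \<in> carrier_mat a a" and B: "B \<in> carrier_mat b b"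
  shows "isometric (osum A B) (osum B A)"
proof (rule isometricI)
  let ?P = "four_block_mat (0\<^sub>m a b) (1\<^sub>m a) (1\<^sub>m b) (0\<^sub>m b a) :: 'a mat"
  let ?P' = "four_block_mat (0\<^sub>m b a) (1\<^sub>m b) (1\<^sub>m a) (0\<^sub>m a b) :: 'a mat"
  show "osum A B \<in> carrier_mat (a + b) (a + b)" "osum B A \<in> carrier_mat (a + b) (a + b)"
    "?P \<in> carrier_mat (a + b) (a + b)" "?P' \<in> carrier_mat (a + b) (a + b)"
    using A B by (auto simp: osum_def)
  show "?P * ?P' = 1\<^sub>m (a + b)"
    by (subst mult_four_block_mat[of _ a b _ a _ b _ _ a _ b]) (auto simp: four_block_one_mat)
  fix x :: "'a vec" assume "x \<in> carrier_vec (a + b)"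
  then have x: "x \<in> carrier_vec (b + a)" by (simp add: add.commute)
  define y z where "y = vec_first x b" and "z = vec_last x a"
  have yz: "x = y @\<^sub>v z" "y \<in> carrier_vec b" "z \<in> carrier_vec a"
    using x by (auto simp: y_def z_def)
  have "?P *\<^sub>v x = z @\<^sub>v y"
    using yz by (simp add: four_block_mat_mult_vec[of _ a b _ a _ b] zero_mult_mat_vec)
  then show "quad_eval (osum A B) (?P *\<^sub>v x) = quad_eval (osum B A) x"
    using yz A B by (simp add: quad_eval_osum[of _ a _ b] quad_eval_osum[of _ b _ a])
qed

text \<open>In the diagonal form \<langle>s, t\<rangle> the vectors (1, 1) and (t, s) have values s
  + t and s t (s + t). They are independent because s + t is nonzero, and the cross term 2 s t
  between them vanishes in characteristic 2. Here the same change of basis acts on blocks.\<close>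

lemma isometric_osum_mix:
  fixes A :: "'a::field mat"
  assumes two: "CHAR('a) = 2" and A: "A \<in> carrier_mat d d" and st: "s + t \<noteq> 0"
  shows "isometric (osum (s \<cdot>\<^sub>m A) (t \<cdot>\<^sub>m A)) (osum ((s + t) \<cdot>\<^sub>m A) ((s * t * (s + t)) \<cdot>\<^sub>m A))"
proof (rule isometricI)
  let ?P = "four_block_mat (1\<^sub>m d) (t \<cdot>\<^sub>m 1\<^sub>m d) (1\<^sub>m d) (s \<cdot>\<^sub>m 1\<^sub>m d)"
  let ?P' = "four_block_mat ((s / (s + t)) \<cdot>\<^sub>m 1\<^sub>m d) ((t / (s + t)) \<cdot>\<^sub>m 1\<^sub>m d)
    ((1 / (s + t)) \<cdot>\<^sub>m 1\<^sub>m d) ((1 / (s + t)) \<cdot>\<^sub>m 1\<^sub>m d)"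
  show "osum (s \<cdot>\<^sub>m A) (t \<cdot>\<^sub>m A) \<in> carrier_mat (d + d) (d + d)"
    "osum ((s + t) \<cdot>\<^sub>m A) ((s * t * (s + t)) \<cdot>\<^sub>m A) \<in> carrier_mat (d + d) (d + d)"
    "?P \<in> carrier_mat (d + d) (d + d)" "?P' \<in> carrier_mat (d + d) (d + d)"
    using A by (auto intro!: carrier_matI)
  have eq: "s / (s + t) + t / (s + t) = 1" "t / (s + t) + s / (s + t) = 1"
    using st by (simp_all add: add_divide_distrib[symmetric] add.commute)
  have mul: "(a \<cdot>\<^sub>m 1\<^sub>m d) * (b \<cdot>\<^sub>m 1\<^sub>m d) = (a * b) \<cdot>\<^sub>m (1\<^sub>m d :: 'a mat)"
    and add: "a \<cdot>\<^sub>m 1\<^sub>m d + b \<cdot>\<^sub>m 1\<^sub>m d = (a + b) \<cdot>\<^sub>m (1\<^sub>m d :: 'a mat)"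
    and zero: "0 \<cdot>\<^sub>m 1\<^sub>m d = (0\<^sub>m d d :: 'a mat)" "1 \<cdot>\<^sub>m 1\<^sub>m d = (1\<^sub>m d :: 'a mat)" for a b
    by (auto intro!: eq_matI)
  show "?P * ?P' = 1\<^sub>m (d + d)"
    by (subst mult_four_block_mat[of _ d d _ d _ d _ _ d _ d])
      (auto simp: mul add zero eq char2_add_self[OF two])
  fix x :: "'a vec" assume x: "x \<in> carrier_vec (d + d)"
  define y z where "y = vec_first x d" and "z = vec_last x d"
  have yz: "x = y @\<^sub>v z" "y \<in> carrier_vec d" "z \<in> carrier_vec d"
    using x by (auto simp: y_def z_def)
  have scale: "(c \<cdot>\<^sub>m 1\<^sub>m d) *\<^sub>v z = c \<cdot>\<^sub>v z" for c
    using yz by (intro eq_vecI) auto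
  have Px: "?P *\<^sub>v x = (y + t \<cdot>\<^sub>v z) @\<^sub>v (y + s \<cdot>\<^sub>v z)"
    using yz by (simp add: four_block_mat_mult_vec[of _ d d _ d _ d] scale)
  have eval: "quad_eval A (y + c \<cdot>\<^sub>v z) = quad_eval A y + c\<^sup>2 * quad_eval A z + c * polar A y z" for c
    using A yz polar_smult_left[OF A yz(3,2), of c]
    by (simp add: quad_eval_add[of _ d] quad_eval_smult_vec[of _ d] polar_commute)
  have "s * (t * polar A y z) + t * (s * polar A y z) = 0"
    by (metis two char2_add_self mult.left_commute)
  then show "quad_eval (osum (s \<cdot>\<^sub>m A) (t \<cdot>\<^sub>m A)) (?P *\<^sub>v x) =
      quad_eval (osum ((s + t) \<cdot>\<^sub>m A) ((s * t * (s + t)) \<cdot>\<^sub>m A)) x"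
    using A yz(2,3) unfolding Px unfolding yz(1)
    by (simp add: quad_eval_osum[of _ d _ d] quad_eval_smult_mat[of _ d] eval
        algebra_simps power2_eq_square)
qed

lemma smult_smult_mat: "a \<cdot>\<^sub>m (b \<cdot>\<^sub>m A) = (a * b) \<cdot>\<^sub>m (A :: 'a::comm_ring_1 mat)"
  by (intro eq_matI) (auto simp: mult.assoc)

lemma one_smult_mat: "1 \<cdot>\<^sub>m A = (A :: 'a::comm_ring_1 mat)"
  by (intro eq_matI) auto

section \<open>Pfister forms as orthogonal sums\<close>

lemma tensor_bil_pfister1:
  assumes A: "A \<in> carrier_mat d d"
  shows "tensor (bil_pfister1 \<beta>) A = osum A (\<beta> \<cdot>\<^sub>m A)"
proof (rule eq_matI)
  fix i j assume "i < dim_row (osum A (\<beta> \<cdot>\<^sub>m A))" "j < dim_col (osum A (\<beta> \<cdot>\<^sub>m A))"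
  with A have ij: "i < d + d" "j < d + d" by (auto simp: osum_def)
  have div_mod: "k div d = (if k < d then 0 else 1)" "k mod d = (if k < d then k else k - d)"
    if "k < d + d" for k
    using that by (auto simp: div_if mod_if)
  show "tensor (bil_pfister1 \<beta>) A $$ (i, j) = osum A (\<beta> \<cdot>\<^sub>m A) $$ (i, j)"
    using A ij
    by (subst tensor_index)
      (auto simp: bil_pfister1_def osum_def mat_of_rows_list_def div_mod)
qed (use A in \<open>auto simp: osum_def bil_pfister1_def mat_of_rows_list_def\<close>)

text \<open>This recursion replaces the index arithmetic of the Kronecker product: inductions on the
  slots now deal with two blocks \<rho> and \<beta>\<rho>.\<close>

lemma quad_pfister_osum:
  "quad_pfister (\<beta> # \<beta>s) \<alpha> = osum (quad_pfister \<beta>s \<alpha>) (\<beta> \<cdot>\<^sub>m quad_pfister \<beta>s \<alpha>)"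
  unfolding quad_pfister_Cons by (rule tensor_bil_pfister1[OF quad_pfister_carrier])

lemma quad_pfister_Nil: "quad_pfister [] \<alpha> = binary_form 1 \<alpha>"
  by (intro eq_matI)
    (auto simp: quad_pfister_def bil_pfister_def tensor_def binary_form_def mat_of_rows_list_def)

section \<open>Forms of dimension 2 and 4 in coordinates\<close>

declare vec_of_list_Nil [simp del] vec_of_list_Cons [simp del]

lemma binary_form_carrier: "binary_form a b \<in> carrier_mat 2 2"
  by (auto simp: binary_form_def mat_of_rows_list_def)

lemma quad_eval_binary_form:
  "quad_eval (binary_form a b) (vec_of_list [x, y]) = a * x\<^sup>2 + x * y + b * y\<^sup>2"
  by (simp add: quad_eval_def binary_form_def mat_of_rows_list_def scalar_prod_def numeral_2_eq_2
      algebra_simps vec_of_list_index)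

lemma vec_of_list_append2:
  "vec_of_list [x, y, z, w] = vec_of_list [x, y] @\<^sub>v vec_of_list [z, w]"
  by (intro eq_vecI) (auto simp: less_Suc_eq numeral_eq_Suc vec_of_list_index)

lemma carrier_vec2E:
  assumes "x \<in> carrier_vec 2"
  obtains a b where "x = vec_of_list [a, b]"
proof
  show "x = vec_of_list [x $ 0, x $ 1]"
    using assms by (intro eq_vecI) (auto simp: less_Suc_eq numeral_eq_Suc vec_of_list_index)
qed

lemma carrier_vec4E:
  assumes "x \<in> carrier_vec 4"
  obtains a b c d where "x = vec_of_list [a, b, c, d]"
proof
  show "x = vec_of_list [x $ 0, x $ 1, x $ 2, x $ 3]"
    using assms by (intro eq_vecI) (auto simp: less_Suc_eq numeral_eq_Suc vec_of_list_index)
qed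

lemma isometric_mat2I:
  fixes A B :: "'a::field mat"
  assumes A: "A \<in> carrier_mat 2 2" and B: "B \<in> carrier_mat 2 2" and det: "a * d - b * c \<noteq> 0"
    and eval: "\<And>x y. quad_eval A (vec_of_list [a * x + b * y, c * x + d * y]) =
      quad_eval B (vec_of_list [x, y])"
  shows "isometric A B"
proof (rule isometricI[OF A B])
  let ?P = "mat_of_rows_list 2 [[a, b], [c, d]]"
  define i where "i = 1 / (a * d - b * c)"
  have i: "(a * d - b * c) * i = 1" using det by (simp add: i_def)
  let ?P' = "mat_of_rows_list 2 [[d * i, - (b * i)], [- (c * i), a * i]]"
  show "?P \<in> carrier_mat 2 2" "?P' \<in> carrier_mat 2 2"
    by (auto simp: mat_of_rows_list_def)
  show "?P * ?P' = 1\<^sub>m 2"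
    by (intro eq_matI)
      (auto simp: mat_of_rows_list_def less_Suc_eq numeral_2_eq_2 scalar_prod_def,
        (use i in \<open>simp add: algebra_simps\<close>)+)
  fix x :: "'a vec" assume "x \<in> carrier_vec 2"
  then obtain y z where x: "x = vec_of_list [y, z]" by (rule carrier_vec2E)
  have "?P *\<^sub>v x = vec_of_list [a * y + b * z, c * y + d * z]"
    by (intro eq_vecI)
      (auto simp: x mat_of_rows_list_def less_Suc_eq numeral_2_eq_2 scalar_prod_def vec_of_list_index)
  then show "quad_eval A (?P *\<^sub>v x) = quad_eval B x"
    using eval[of y z] by (simp add: x)
qed

text \<open>The new basis is e_1, e_2 + u e_4, e_1 + e_3, v e_4. Both explicit isometries of 2-fold
  Pfister forms below have this shape; the multiple of e_4 in the second vector restores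
  orthogonality to e_1 + e_3.\<close>

lemma isometric_mat4I:
  fixes A B :: "'a::field mat"
  assumes A: "A \<in> carrier_mat 4 4" and B: "B \<in> carrier_mat 4 4" and v: "v \<noteq> 0"
    and eval: "\<And>x y z w. quad_eval A (vec_of_list [x + z, y, z, u * y + v * w]) =
      quad_eval B (vec_of_list [x, y, z, w])"
  shows "isometric A B"
proof (rule isometricI[OF A B])
  let ?P = "mat_of_rows_list 4 [[1, 0, 1, 0], [0, 1, 0, 0], [0, 0, 1, 0], [0, u, 0, v]]"
  let ?P' = "mat_of_rows_list 4 [[1, 0, - 1, 0], [0, 1, 0, 0], [0, 0, 1, 0], [0, - (u / v), 0, 1 / v]]"
  show "?P \<in> carrier_mat 4 4" "?P' \<in> carrier_mat 4 4"
    by (auto simp: mat_of_rows_list_def)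
  show "?P * ?P' = 1\<^sub>m 4"
    using v by (intro eq_matI)
      (auto simp: mat_of_rows_list_def less_Suc_eq numeral_eq_Suc scalar_prod_def)
  fix x :: "'a vec" assume "x \<in> carrier_vec 4"
  then obtain a b c d where x: "x = vec_of_list [a, b, c, d]" by (rule carrier_vec4E)
  have "?P *\<^sub>v x = vec_of_list [a + c, b, c, u * b + v * d]"
    by (intro eq_vecI)
      (auto simp: x mat_of_rows_list_def less_Suc_eq numeral_eq_Suc scalar_prod_def vec_of_list_index)
  then show "quad_eval A (?P *\<^sub>v x) = quad_eval B x"
    using eval[of a c b d] by (simp add: x)
qed

lemma quad_eval_osum_binary:
  assumes "A \<in> carrier_mat 2 2" "B \<in> carrier_mat 2 2"
  shows "quad_eval (osum A B) (vec_of_list [x, y, z, w]) =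
    quad_eval A (vec_of_list [x, y]) + quad_eval B (vec_of_list [z, w])"
  unfolding vec_of_list_append2
  by (rule quad_eval_osum[OF assms]) (auto intro: carrier_vecI)

subsection \<open>Hyperbolic forms\<close>

abbreviation hyp :: "nat \<Rightarrow> 'a::comm_ring_1 mat" where
  "hyp m \<equiv> diag_block_mat (replicate m (binary_form 0 0))"

text \<open>\<open>osum\<close> has the block layout that \<open>diag_block_mat\<close> produces, so
  splitting off a hyperbolic plane is an equality of matrices and not merely an isometry.\<close>

lemma hyp_Suc: "hyp (Suc m) = osum (binary_form 0 0) (hyp m)"
  by (simp add: osum_def Let_def)

lemma hyp_add: "hyp (m + k) = osum (hyp m) (hyp k)"
  by (simp add: replicate_add diag_block_mat_append osum_def Let_def)

lemma hyp_carrier: "hyp m \<in> carrier_mat (2 * m) (2 * m)"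
proof (induction m)
  case (Suc m)
  from osum_carrier[OF binary_form_carrier Suc] show ?case unfolding hyp_Suc by simp
qed simp

lemma hyperbolic_hyp: "hyperbolic (hyp m)"
  unfolding hyperbolic_def using isometric_refl[OF hyp_carrier] by blast

lemma hyperbolic_plane: "hyperbolic (binary_form 0 0)"
  using hyperbolic_hyp[of 1] by (simp del: diag_block_mat.simps)

lemma hyperbolic_isometric:
  fixes A B :: "'a::field mat"
  assumes "isometric A B" "hyperbolic B"
  shows "hyperbolic A"
  using assms isometric_trans unfolding hyperbolic_def by blast

lemma hyperbolic_osum:
  fixes A B :: "'a::field mat"
  assumes "hyperbolic A" "hyperbolic B"
  shows "hyperbolic (osum A B)"
  using assms isometric_osum unfolding hyperbolic_def by (metis hyp_add)

lemma isometric_hyperbolic: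
  fixes A B :: "'a::field mat"
  assumes "hyperbolic A" "hyperbolic B" "A \<in> carrier_mat d d" "B \<in> carrier_mat d d"
  shows "isometric A B"
proof -
  from assms obtain m k where mk: "isometric A (hyp m)" "isometric B (hyp k)"
    unfolding hyperbolic_def by auto
  from mk(1) assms(3) have "dim_row (hyp m :: 'a mat) = d" by (auto simp: isometric_def)
  moreover from mk(2) assms(4) have "dim_row (hyp k :: 'a mat) = d" by (auto simp: isometric_def)
  ultimately have "m = k"
    using carrier_matD(1)[OF hyp_carrier[where 'a = 'a, of m]]
      carrier_matD(1)[OF hyp_carrier[where 'a = 'a, of k]] by simp
  with mk show ?thesis using isometric_trans isometric_sym by blast
qed

lemma hyperbolic_smult:
  fixes A :: "'a::field mat"
  assumes A: "hyperbolic A" and c: "c \<noteq> 0"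
  shows "hyperbolic (c \<cdot>\<^sub>m A)"
proof -
  have H: "isometric (c \<cdot>\<^sub>m binary_form 0 0) (binary_form 0 0)"
  proof (rule isometric_mat2I[where a = "1 / c" and b = 0 and c = 0 and d = 1])
    show "quad_eval (c \<cdot>\<^sub>m binary_form 0 0) (vec_of_list [1 / c * x + 0 * y, 0 * x + 1 * y]) =
      quad_eval (binary_form 0 0) (vec_of_list [x, y])" for x y
      using c by (simp add: quad_eval_smult_mat[OF binary_form_carrier] quad_eval_binary_form
          carrier_vecI)
  qed (use c in \<open>auto simp: binary_form_carrier\<close>)
  have "hyperbolic (c \<cdot>\<^sub>m hyp m :: 'a mat)" for m
  proof (induction m)
    case 0
    have "c \<cdot>\<^sub>m hyp 0 = (hyp 0 :: 'a mat)" by (intro eq_matI) auto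
    then show ?case using hyperbolic_hyp[of 0] by simp
  next
    case (Suc m)
    have "hyperbolic (c \<cdot>\<^sub>m binary_form 0 0)"
      using H hyperbolic_plane by (rule hyperbolic_isometric)
    with Suc show ?case unfolding hyp_Suc osum_smult by (rule hyperbolic_osum[rotated])
  qed
  with A show ?thesis
    unfolding hyperbolic_def using isometric_smult isometric_trans by metis
qed

text \<open>The form factors as x (a x + y), and a x + y serves as the second coordinate of the
  plane.\<close>

lemma hyperbolic_binary_form: "hyperbolic (binary_form (a :: 'a::field) 0)"
proof (rule hyperbolic_isometric)
  show "isometric (binary_form a 0) (binary_form 0 0)"
    by (rule isometric_mat2I[where a = 1 and b = 0 and c = "- a" and d = 1])
      (auto simp: binary_form_carrier quad_eval_binary_form algebra_simps power2_eq_square)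
  show "hyperbolic (binary_form (0 :: 'a) 0)" by (rule hyperbolic_plane)
qed

lemma hyperbolic_binary_form': "hyperbolic (binary_form 0 (a :: 'a::field))"
proof (rule hyperbolic_isometric)
  show "isometric (binary_form 0 a) (binary_form 0 0)"
    by (rule isometric_mat2I[where a = 1 and b = "- a" and c = 0 and d = 1])
      (auto simp: binary_form_carrier quad_eval_binary_form algebra_simps power2_eq_square)
  show "hyperbolic (binary_form (0 :: 'a) 0)" by (rule hyperbolic_plane)
qed

subsection \<open>Isometries of Pfister forms\<close>

lemma hyperbolic_quad_pfister_Cons:
  fixes \<beta> :: "'a::field"
  assumes "hyperbolic (quad_pfister \<beta>s \<alpha>)" "\<beta> \<noteq> 0"
  shows "hyperbolic (quad_pfister (\<beta> # \<beta>s) \<alpha>)"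
  unfolding quad_pfister_osum using assms by (intro hyperbolic_osum hyperbolic_smult)

text \<open>This gives a hyperbolic form with any prescribed nonzero bilinear slots. As hyperbolic
  forms of equal dimension are isometric, a hyperbolic Pfister form can be rewritten with whatever
  slots are convenient.\<close>

lemma hyperbolic_quad_pfister_0:
  fixes \<beta>s :: "'a::field list"
  assumes "0 \<notin> set \<beta>s"
  shows "hyperbolic (quad_pfister \<beta>s 0)"
  using assms
  by (induction \<beta>s) (auto simp: quad_pfister_Nil hyperbolic_binary_form intro!: hyperbolic_quad_pfister_Cons)

lemma isometric_quad_pfister_Cons:
  fixes \<beta> :: "'a::field"
  assumes "isometric (quad_pfister \<beta>s \<alpha>) (quad_pfister \<beta>s' \<alpha>')"
  shows "isometric (quad_pfister (\<beta> # \<beta>s) \<alpha>) (quad_pfister (\<beta> # \<beta>s') \<alpha>')"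
  unfolding quad_pfister_osum using assms by (intro isometric_osum isometric_smult)

lemma isometric_quad_pfister_swap:
  fixes \<beta> \<gamma> :: "'a::field"
  shows "isometric (quad_pfister (\<beta> # \<gamma> # \<beta>s) \<alpha>) (quad_pfister (\<gamma> # \<beta> # \<beta>s) \<alpha>)"
proof -
  define R where "R = quad_pfister \<beta>s \<alpha>"
  have R: "R \<in> carrier_mat (2 ^ Suc (length \<beta>s)) (2 ^ Suc (length \<beta>s))"
    unfolding R_def by (rule quad_pfister_carrier)
  note cR = smult_carrier_mat[OF R]
  have eq: "quad_pfister (b # c # \<beta>s) \<alpha> =
      osum R (osum (osum (c \<cdot>\<^sub>m R) (b \<cdot>\<^sub>m R)) ((b * c) \<cdot>\<^sub>m R))" for b c
    by (simp add: quad_pfister_osum R_def osum_assoc osum_smult smult_smult_mat)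
  show ?thesis
    unfolding eq mult.commute[of \<beta> \<gamma>]
    by (rule isometric_osum[OF isometric_refl[OF R]
          isometric_osum[OF isometric_osum_commute[OF cR cR] isometric_refl[OF cR]]])
qed

text \<open>The slots \<open>\<beta>s\<close> stand between the two entries that the 2-fold isometry
  changes, while the recursion only adds slots in front. So each slot is first moved past \<beta>,
  and moved back past \<gamma> afterwards.\<close>

lemma isometric_quad_pfister_front:
  fixes \<beta> \<gamma> :: "'a::field"
  assumes "isometric (quad_pfister [\<beta>] \<alpha>) (quad_pfister [\<gamma>] \<alpha>')"
  shows "isometric (quad_pfister (\<beta> # \<beta>s) \<alpha>) (quad_pfister (\<gamma> # \<beta>s) \<alpha>')"
proof (induction \<beta>s)
  case (Cons \<epsilon> \<beta>s)
  have "isometric (quad_pfister (\<beta> # \<epsilon> # \<beta>s) \<alpha>) (quad_pfister (\<epsilon> # \<beta> # \<beta>s) \<alpha>)"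
    by (rule isometric_quad_pfister_swap)
  also have "isometric \<dots> (quad_pfister (\<epsilon> # \<gamma> # \<beta>s) \<alpha>')"
    using Cons by (rule isometric_quad_pfister_Cons)
  also have "isometric \<dots> (quad_pfister (\<gamma> # \<epsilon> # \<beta>s) \<alpha>')"
    by (rule isometric_quad_pfister_swap)
  finally show ?case .
qed (rule assms)

text \<open>
  In \<open>\<langle>\<langle>1 + \<delta>, \<alpha>]]\<close> the totally singular subform \<open>\<langle>1, 1 + \<delta>\<rangle>\<close> spanned by the vectors \<open>e\<^sub>1, e\<^sub>3\<close> is
  isometric to \<open>\<langle>1, \<delta>\<rangle>\<close>, spanned by \<open>e\<^sub>1, e\<^sub>1 + e\<^sub>3\<close>; a basis extending the latter gives \<open>\<langle>\<langle>\<delta>, \<alpha>']]\<close>.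
\<close>

lemma isometric_quad_pfister_shift:
  fixes \<delta> \<alpha> :: "'a::field"
  assumes two: "CHAR('a) = 2" and \<delta>: "\<delta> \<noteq> 0" "1 + \<delta> \<noteq> 0"
  shows "isometric (quad_pfister ((1 + \<delta>) # \<beta>s) \<alpha>) (quad_pfister (\<delta> # \<beta>s) (\<alpha> * \<delta> / (1 + \<delta>)))"
proof (rule isometric_quad_pfister_front, rule isometric_mat4I)
  show "quad_pfister [1 + \<delta>] \<alpha> \<in> carrier_mat 4 4"
    "quad_pfister [\<delta>] (\<alpha> * \<delta> / (1 + \<delta>)) \<in> carrier_mat 4 4"
    using quad_pfister_carrier[of "[1 + \<delta>]" \<alpha>] quad_pfister_carrier[of "[\<delta>]" "\<alpha> * \<delta> / (1 + \<delta>)"] by simp_all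
  show "\<delta> / (1 + \<delta>) \<noteq> 0" using \<delta> by simp
  fix x y z w
  define v where "v = 1 / (1 + \<delta>)"
  have v: "v * (1 + \<delta>) = 1" using \<delta> by (simp add: v_def)
  \<comment> \<open>The fourth coordinate after the substitution. It is chosen so that (1 +
    \<delta>) z s contributes z y, which cancels the z y in (x + z) y. The constant in the new last
    slot arises from 1 + v = \<delta> v in characteristic 2, the factor of \<alpha> y^2.\<close>
  define s where "s = v * (y + \<delta> * w)"
  have s: "(1 + \<delta>) * s = y + \<delta> * w"
    using v by (simp add: s_def mult.assoc[symmetric] mult.commute)
  have "(x + z)\<^sup>2 + (x + z) * y + \<alpha> * y\<^sup>2 + (1 + \<delta>) * (z\<^sup>2 + z * s + \<alpha> * s\<^sup>2) =
      (x + z)\<^sup>2 + (x + z) * y + \<alpha> * (v * (1 + \<delta>)) * y\<^sup>2 +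
      ((1 + \<delta>) * z\<^sup>2 + z * ((1 + \<delta>) * s) + \<alpha> * s * ((1 + \<delta>) * s))"
    unfolding v by (simp add: algebra_simps power2_eq_square)
  also have "\<dots> = x\<^sup>2 + x * y + \<alpha> * \<delta> * v * y\<^sup>2 + \<delta> * (z\<^sup>2 + z * w + \<alpha> * \<delta> * v * w\<^sup>2) +
      2 * (x * z + z\<^sup>2 + z * y + \<alpha> * v * \<delta> * y * w + \<alpha> * v * y\<^sup>2)"
    unfolding s unfolding s_def by (simp add: algebra_simps power2_eq_square)
  finally have "(x + z)\<^sup>2 + (x + z) * y + \<alpha> * y\<^sup>2 +
      (1 + \<delta>) * (z\<^sup>2 + z * (v * y + \<delta> * v * w) + \<alpha> * (v * y + \<delta> * v * w)\<^sup>2) =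
      x\<^sup>2 + x * y + \<alpha> * \<delta> * v * y\<^sup>2 + \<delta> * (z\<^sup>2 + z * w + \<alpha> * \<delta> * v * w\<^sup>2)"
    unfolding char2_mult_2[OF two] s_def by (simp add: algebra_simps)
  then show "quad_eval (quad_pfister [1 + \<delta>] \<alpha>)
      (vec_of_list [x + z, y, z, 1 / (1 + \<delta>) * y + \<delta> / (1 + \<delta>) * w]) =
    quad_eval (quad_pfister [\<delta>] (\<alpha> * \<delta> / (1 + \<delta>))) (vec_of_list [x, y, z, w])"
    by (simp add: quad_pfister_osum quad_pfister_Nil quad_eval_osum_binary binary_form_carrier
        quad_eval_smult_mat[OF binary_form_carrier] carrier_vecI quad_eval_binary_form v_def)
qed

text \<open>In two equal copies of [1, \<alpha>], the diagonal vectors e_1 + e_3 and e_2 + e_4 have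
  value 0 in characteristic 2. They lie in the orthogonal planes spanned by e_1 + e_3, e_4 and by
  e_1, e_2 + e_4.\<close>

lemma hyperbolic_quad_pfister_1:
  fixes \<alpha> :: "'a::field"
  assumes two: "CHAR('a) = 2" and \<beta>s: "0 \<notin> set \<beta>s"
  shows "hyperbolic (quad_pfister (1 # \<beta>s) \<alpha>)"
proof -
  have carrier: "quad_pfister [1] a \<in> carrier_mat 4 4" for a :: 'a
    using quad_pfister_carrier[of "[1]" a] by simp
  have "isometric (quad_pfister [1] \<alpha>) (osum (binary_form 1 0) (binary_form 0 \<alpha>))"
  proof (rule isometric_mat4I[OF carrier])
    show "osum (binary_form 1 0) (binary_form 0 \<alpha>) \<in> carrier_mat 4 4"
      using osum_carrier[OF binary_form_carrier binary_form_carrier, of 1 0 0 \<alpha>] by simp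
    show "(1 :: 'a) \<noteq> 0" by simp
    fix x y z w
    have "(x + z)\<^sup>2 + (x + z) * y + \<alpha> * y\<^sup>2 + (z\<^sup>2 + z * (y + w) + \<alpha> * (y + w)\<^sup>2) =
        x\<^sup>2 + x * y + (z * w + \<alpha> * w\<^sup>2) + 2 * (x * z + z\<^sup>2 + z * y + \<alpha> * y\<^sup>2 + \<alpha> * y * w)"
      by (simp add: algebra_simps power2_eq_square)
    then have "(x + z)\<^sup>2 + (x + z) * y + \<alpha> * y\<^sup>2 + (z\<^sup>2 + z * (y + w) + \<alpha> * (y + w)\<^sup>2) =
        x\<^sup>2 + x * y + (z * w + \<alpha> * w\<^sup>2)"
      unfolding char2_mult_2[OF two] by simp
    then show "quad_eval (quad_pfister [1] \<alpha>) (vec_of_list [x + z, y, z, 1 * y + 1 * w]) =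
      quad_eval (osum (binary_form 1 0) (binary_form 0 \<alpha>)) (vec_of_list [x, y, z, w])"
      by (simp add: quad_pfister_osum quad_pfister_Nil quad_eval_osum_binary binary_form_carrier
          one_smult_mat quad_eval_binary_form)
  qed
  then have "hyperbolic (quad_pfister [1] \<alpha>)"
    by (rule hyperbolic_isometric)
      (intro hyperbolic_osum hyperbolic_binary_form hyperbolic_binary_form')
  \<comment> \<open>Only isometries can be carried past the remaining slots, so hyperbolicity is
    restated as an isometry with a form that stays hyperbolic for all slots.\<close>
  then have "isometric (quad_pfister [1] \<alpha>) (quad_pfister [1] 0)"
    using hyperbolic_quad_pfister_0[of "[1]"] carrier by (intro isometric_hyperbolic) auto
  then have "isometric (quad_pfister (1 # \<beta>s) \<alpha>) (quad_pfister (1 # \<beta>s) 0)"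
    by (rule isometric_quad_pfister_front)
  then show ?thesis
    using hyperbolic_quad_pfister_0[of "1 # \<beta>s"] \<beta>s by (simp add: hyperbolic_isometric)
qed

text \<open>Together with roundness, this allows the first slot to be multiplied by any nonzero
  value of the remaining form.\<close>

lemma isometric_quad_pfister_scale:
  fixes \<beta> s :: "'a::field"
  assumes "isometric (s \<cdot>\<^sub>m quad_pfister \<beta>s \<alpha>) (quad_pfister \<beta>s \<alpha>)"
  shows "isometric (quad_pfister (\<beta> # \<beta>s) \<alpha>) (quad_pfister ((\<beta> * s) # \<beta>s) \<alpha>)"
proof -
  have "isometric (\<beta> \<cdot>\<^sub>m quad_pfister \<beta>s \<alpha>) (\<beta> \<cdot>\<^sub>m (s \<cdot>\<^sub>m quad_pfister \<beta>s \<alpha>))"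
    using isometric_sym[OF assms] by (rule isometric_smult)
  then show ?thesis
    unfolding quad_pfister_osum smult_smult_mat
    by (intro isometric_osum isometric_refl[OF quad_pfister_carrier])
qed

lemma quad_pfister_split:
  fixes \<beta> :: "'a::field"
  assumes "x \<in> carrier_vec (2 ^ Suc (length (\<beta> # \<beta>s)))"
  obtains y z where "x = y @\<^sub>v z" "y \<in> carrier_vec (2 ^ Suc (length \<beta>s))"
    "z \<in> carrier_vec (2 ^ Suc (length \<beta>s))"
    "quad_eval (quad_pfister (\<beta> # \<beta>s) \<alpha>) x =
      quad_eval (quad_pfister \<beta>s \<alpha>) y + \<beta> * quad_eval (quad_pfister \<beta>s \<alpha>) z"
proof
  let ?n = "2 ^ Suc (length \<beta>s)"
  have x: "x \<in> carrier_vec (?n + ?n)" using assms by simp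
  show *: "x = vec_first x ?n @\<^sub>v vec_last x ?n" using x by simp
  note R = quad_pfister_carrier[of \<beta>s \<alpha>]
  show "quad_eval (quad_pfister (\<beta> # \<beta>s) \<alpha>) x =
      quad_eval (quad_pfister \<beta>s \<alpha>) (vec_first x ?n) + \<beta> * quad_eval (quad_pfister \<beta>s \<alpha>) (vec_last x ?n)"
    unfolding quad_pfister_osum
    by (subst *, subst quad_eval_osum[OF R smult_carrier_mat[OF R]])
      (simp_all del: power_Suc add: quad_eval_smult_mat[OF R])
qed simp_all

text \<open>In the main case, \<open>\<langle>1, \<beta>\<rangle>\<rho> \<cong> \<langle>s, \<beta>t\<rangle>\<rho> \<cong> c\<langle>1, s\<beta>t\<rangle>\<rho> \<cong> c\<langle>1, \<beta>\<rangle>\<rho>\<close>.\<close>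

lemma quad_pfister_round:
  fixes \<beta>s :: "'a::field list"
  assumes two: "CHAR('a) = 2" and "0 \<notin> set \<beta>s"
    and "x \<in> carrier_vec (2 ^ Suc (length \<beta>s))"
    and "quad_eval (quad_pfister \<beta>s \<alpha>) x \<noteq> 0"
  shows "isometric (quad_eval (quad_pfister \<beta>s \<alpha>) x \<cdot>\<^sub>m quad_pfister \<beta>s \<alpha>) (quad_pfister \<beta>s \<alpha>)"
  using assms(2-)
proof (induction \<beta>s arbitrary: x)
  case Nil
  then obtain a b where x: "x = vec_of_list [a, b]" by (auto elim: carrier_vec2E)
  define c where "c = a\<^sup>2 + a * b + \<alpha> * b\<^sup>2"
  have c: "quad_eval (quad_pfister [] \<alpha>) x = c"
    by (simp add: quad_pfister_Nil x quad_eval_binary_form c_def)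
  have "a * (a + b) - \<alpha> * b * b = c - 2 * (\<alpha> * b\<^sup>2)"
    by (simp add: c_def algebra_simps power2_eq_square)
  then have det: "a * (a + b) - \<alpha> * b * b = c" unfolding char2_mult_2[OF two] by simp
  \<comment> \<open>The form is the norm form of the algebra F[\<omega>] with \<omega>^2 = \<omega>
    + \<alpha>. The matrix is multiplication by a + b \<omega>, whose norm and determinant are
    c.\<close>
  have "isometric (binary_form 1 \<alpha>) (c \<cdot>\<^sub>m binary_form 1 \<alpha>)"
  proof (rule isometric_mat2I[where a = a and b = "\<alpha> * b" and c = b and d = "a + b"])
    show "a * (a + b) - \<alpha> * b * b \<noteq> 0" using det Nil(3) by (simp add: c)
    fix y z
    have "(a * y + \<alpha> * b * z)\<^sup>2 + (a * y + \<alpha> * b * z) * (b * y + (a + b) * z) +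
        \<alpha> * (b * y + (a + b) * z)\<^sup>2 = c * (y\<^sup>2 + y * z + \<alpha> * z\<^sup>2) +
        2 * (\<alpha> * b * (a + b) * z\<^sup>2 + \<alpha> * b * (2 * a + b) * y * z)"
      by (simp add: c_def algebra_simps power2_eq_square)
    then have "(a * y + \<alpha> * b * z)\<^sup>2 + (a * y + \<alpha> * b * z) * (b * y + (a + b) * z) +
        \<alpha> * (b * y + (a + b) * z)\<^sup>2 = c * (y\<^sup>2 + y * z + \<alpha> * z\<^sup>2)"
      unfolding char2_mult_2[OF two, of "_ + _"] by simp
    then show "quad_eval (binary_form 1 \<alpha>) (vec_of_list [a * y + \<alpha> * b * z, b * y + (a + b) * z]) =
        quad_eval (c \<cdot>\<^sub>m binary_form 1 \<alpha>) (vec_of_list [y, z])"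
      by (simp add: quad_eval_smult_mat[OF binary_form_carrier] carrier_vecI quad_eval_binary_form)
  qed (auto simp: binary_form_carrier)
  then show ?case unfolding c unfolding quad_pfister_Nil by (rule isometric_sym)
next
  case (Cons \<beta> \<beta>s)
  define R where "R = quad_pfister \<beta>s \<alpha>"
  have R: "R \<in> carrier_mat (2 ^ Suc (length \<beta>s)) (2 ^ Suc (length \<beta>s))"
    unfolding R_def by (rule quad_pfister_carrier)
  have T: "quad_pfister (\<beta> # \<beta>s) \<alpha> = osum R (\<beta> \<cdot>\<^sub>m R)"
    unfolding R_def by (rule quad_pfister_osum)
  obtain y z where y: "y \<in> carrier_vec (2 ^ Suc (length \<beta>s))"
    and z: "z \<in> carrier_vec (2 ^ Suc (length \<beta>s))"
    and eval: "quad_eval (quad_pfister (\<beta> # \<beta>s) \<alpha>) x = quad_eval R y + \<beta> * quad_eval R z"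
    using quad_pfister_split[OF Cons.prems(2), of \<alpha>] unfolding R_def by metis
  define s t where "s = quad_eval R y" and "t = quad_eval R z"
  have s: "isometric (s \<cdot>\<^sub>m R) R" if "s \<noteq> 0"
    using Cons.IH[OF _ y] Cons.prems(1) that unfolding s_def R_def by simp
  have t: "isometric (t \<cdot>\<^sub>m R) R" if "t \<noteq> 0"
    using Cons.IH[OF _ z] Cons.prems(1) that unfolding t_def R_def by simp
  define c where "c = s + \<beta> * t"
  have c: "quad_eval (quad_pfister (\<beta> # \<beta>s) \<alpha>) x = c" by (simp add: eval c_def s_def t_def)
  have "c \<noteq> 0" and \<beta>: "\<beta> \<noteq> 0" using Cons.prems c by auto
  \<comment> \<open>The induction hypothesis makes only nonzero values into similarity factors, so
    the cases where s or t vanishes are separate. If s = 0, scaling by c = \<beta> t interchanges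
    the two blocks up to the square \<open>\<beta>\<^sup>2\<close>.\<close>
  consider "t = 0" | "s = 0" "t \<noteq> 0" | "s \<noteq> 0" "t \<noteq> 0" by blast
  then have "isometric (c \<cdot>\<^sub>m osum R (\<beta> \<cdot>\<^sub>m R)) (osum R (\<beta> \<cdot>\<^sub>m R))"
  proof cases
    case 1
    then have "c = s" "s \<noteq> 0" using \<open>c \<noteq> 0\<close> by (auto simp: c_def)
    have "isometric (\<beta> \<cdot>\<^sub>m (s \<cdot>\<^sub>m R)) (\<beta> \<cdot>\<^sub>m R)"
      using s[OF \<open>s \<noteq> 0\<close>] by (rule isometric_smult)
    with s[OF \<open>s \<noteq> 0\<close>] show ?thesis
      unfolding osum_smult \<open>c = s\<close> smult_smult_mat mult.commute[of s] by (rule isometric_osum)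
  next
    case 2
    have "isometric (\<beta> \<cdot>\<^sub>m (t \<cdot>\<^sub>m R)) (\<beta> \<cdot>\<^sub>m R)"
      using t[OF 2(2)] by (rule isometric_smult)
    moreover have "isometric (\<beta>\<^sup>2 \<cdot>\<^sub>m (t \<cdot>\<^sub>m R)) R"
      using isometric_trans[OF isometric_square[OF smult_carrier_mat[OF R] \<beta>] t[OF 2(2)]] .
    ultimately have "isometric (osum (\<beta> \<cdot>\<^sub>m (t \<cdot>\<^sub>m R)) (\<beta>\<^sup>2 \<cdot>\<^sub>m (t \<cdot>\<^sub>m R))) (osum (\<beta> \<cdot>\<^sub>m R) R)"
      by (rule isometric_osum)
    moreover have "c \<cdot>\<^sub>m osum R (\<beta> \<cdot>\<^sub>m R) = osum (\<beta> \<cdot>\<^sub>m (t \<cdot>\<^sub>m R)) (\<beta>\<^sup>2 \<cdot>\<^sub>m (t \<cdot>\<^sub>m R))"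
      using 2 by (simp add: osum_smult smult_smult_mat c_def power2_eq_square mult_ac)
    ultimately show ?thesis
      using isometric_osum_commute[OF smult_carrier_mat[OF R] R] isometric_trans by metis
  next
    case 3
    have "isometric (osum R (\<beta> \<cdot>\<^sub>m R)) (osum (s \<cdot>\<^sub>m R) (\<beta> \<cdot>\<^sub>m (t \<cdot>\<^sub>m R)))"
      using isometric_sym[OF s[OF 3(1)]] isometric_sym[OF t[OF 3(2)]]
      by (intro isometric_osum isometric_smult)
    also have "isometric \<dots> (osum (c \<cdot>\<^sub>m R) ((s * (\<beta> * t) * c) \<cdot>\<^sub>m R))"
      using isometric_osum_mix[OF two R, of s "\<beta> * t"] \<open>c \<noteq> 0\<close>
      by (simp add: c_def smult_smult_mat)
    also have "(s * (\<beta> * t) * c) \<cdot>\<^sub>m R = c \<cdot>\<^sub>m (\<beta> \<cdot>\<^sub>m (s \<cdot>\<^sub>m (t \<cdot>\<^sub>m R)))"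
      by (simp add: smult_smult_mat mult_ac)
    also have "isometric (osum (c \<cdot>\<^sub>m R) \<dots>) (osum (c \<cdot>\<^sub>m R) (c \<cdot>\<^sub>m (\<beta> \<cdot>\<^sub>m R)))"
      using isometric_trans[OF isometric_smult[OF t[OF 3(2)], of s] s[OF 3(1)]]
      by (intro isometric_osum isometric_smult isometric_refl[OF smult_carrier_mat[OF R]])
    finally show ?thesis unfolding osum_smult by (rule isometric_sym)
  qed
  then show ?case unfolding c unfolding T .
qed

text \<open>Let \<rho> be the form without the slot \<beta>. A zero means \<rho>(y) =
  \<beta>\<rho>(z). If these values are nonzero, roundness changes the slot \<beta> to
  \<beta>\<rho>(z) = \<rho>(y) and then to 1, which is hyperbolic in characteristic 2. If they are
  zero, \<rho> is itself isotropic and the induction hypothesis applies.\<close>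

lemma isotropic_imp_hyperbolic:
  fixes \<beta>s :: "'a::field list"
  assumes two: "CHAR('a) = 2" and "0 \<notin> set \<beta>s"
    and "x \<in> carrier_vec (2 ^ Suc (length \<beta>s))" and "x \<noteq> 0\<^sub>v (2 ^ Suc (length \<beta>s))"
    and "quad_eval (quad_pfister \<beta>s \<alpha>) x = 0"
  shows "hyperbolic (quad_pfister \<beta>s \<alpha>)"
  using assms(2-)
proof (induction \<beta>s arbitrary: x)
  case Nil
  then obtain a b where x: "x = vec_of_list [a, b]" by (auto elim: carrier_vec2E)
  have eq: "a\<^sup>2 + a * b + \<alpha> * b\<^sup>2 = 0"
    using Nil by (simp add: quad_pfister_Nil x quad_eval_binary_form)
  have "b \<noteq> 0"
  proof
    assume "b = 0"
    with eq have "x = 0\<^sub>v 2"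
      by (intro eq_vecI) (auto simp: x less_Suc_eq numeral_eq_Suc vec_of_list_index)
    with Nil show False by simp
  qed
  \<comment> \<open>A root of X^2 + X + \<alpha>; the substitution of y + c z for y therefore
    removes \<alpha>.\<close>
  define c where "c = a / b"
  have "b\<^sup>2 * (c\<^sup>2 + c + \<alpha>) = 0"
    using eq \<open>b \<noteq> 0\<close> by (simp add: c_def field_simps power2_eq_square)
  then have c: "c\<^sup>2 + c + \<alpha> = 0" using \<open>b \<noteq> 0\<close> by simp
  have "isometric (binary_form 1 \<alpha>) (binary_form 1 0)"
  proof (rule isometric_mat2I[where a = 1 and b = c and c = 0 and d = 1])
    fix y z
    have "(y + c * z)\<^sup>2 + (y + c * z) * z + \<alpha> * z\<^sup>2 =
        y\<^sup>2 + y * z + (c\<^sup>2 + c + \<alpha>) * z\<^sup>2 + 2 * (c * y * z)"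
      by (simp add: algebra_simps power2_eq_square)
    then have "(y + c * z)\<^sup>2 + (y + c * z) * z + \<alpha> * z\<^sup>2 = y\<^sup>2 + y * z"
      unfolding c char2_mult_2[OF two] by simp
    then show "quad_eval (binary_form 1 \<alpha>) (vec_of_list [1 * y + c * z, 0 * y + 1 * z]) =
        quad_eval (binary_form 1 0) (vec_of_list [y, z])"
      by (simp add: quad_eval_binary_form)
  qed (auto simp: binary_form_carrier)
  then show ?case
    unfolding quad_pfister_Nil using hyperbolic_binary_form by (rule hyperbolic_isometric)
next
  case (Cons \<beta> \<beta>s)
  define R where "R = quad_pfister \<beta>s \<alpha>"
  have R: "R \<in> carrier_mat (2 ^ Suc (length \<beta>s)) (2 ^ Suc (length \<beta>s))"
    unfolding R_def by (rule quad_pfister_carrier)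
  obtain y z where x: "x = y @\<^sub>v z" and y: "y \<in> carrier_vec (2 ^ Suc (length \<beta>s))"
    and z: "z \<in> carrier_vec (2 ^ Suc (length \<beta>s))"
    and eval: "quad_eval (quad_pfister (\<beta> # \<beta>s) \<alpha>) x = quad_eval R y + \<beta> * quad_eval R z"
    using quad_pfister_split[OF Cons.prems(2), of \<alpha>] unfolding R_def by metis
  define s t where "s = quad_eval R y" and "t = quad_eval R z"
  have \<beta>: "\<beta> \<noteq> 0" "0 \<notin> set \<beta>s" using Cons.prems by auto
  have "s - \<beta> * t = 0"
    using Cons.prems(4) eval char2_minus[OF two, of s "\<beta> * t"] by (simp add: s_def t_def)
  then have st: "s = \<beta> * t" by simp
  show ?case
  proof (cases "t = 0")
    case True
    have "y \<noteq> 0\<^sub>v (2 ^ Suc (length \<beta>s)) \<or> z \<noteq> 0\<^sub>v (2 ^ Suc (length \<beta>s))"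
    proof (rule ccontr)
      assume "\<not> ?thesis"
      with x have "x = 0\<^sub>v (2 ^ Suc (length (\<beta> # \<beta>s)))"
        by (intro eq_vecI) auto
      with Cons.prems show False by simp
    qed
    then have "hyperbolic R"
      using Cons.IH[OF \<beta>(2) y] Cons.IH[OF \<beta>(2) z] st True
      by (auto simp: s_def t_def R_def)
    then show ?thesis using \<beta> unfolding R_def by (intro hyperbolic_quad_pfister_Cons)
  next
    case False
    with st \<beta> have "s \<noteq> 0" by simp
    have "isometric (s \<cdot>\<^sub>m R) R" "isometric (t \<cdot>\<^sub>m R) R"
      using quad_pfister_round[OF two \<beta>(2) y, of \<alpha>] quad_pfister_round[OF two \<beta>(2) z, of \<alpha>]
        \<open>s \<noteq> 0\<close> False by (auto simp: s_def t_def R_def)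
    then have "isometric (quad_pfister (\<beta> # \<beta>s) \<alpha>) (quad_pfister (s # \<beta>s) \<alpha>)"
      "isometric (quad_pfister (1 # \<beta>s) \<alpha>) (quad_pfister (s # \<beta>s) \<alpha>)"
      using isometric_quad_pfister_scale[of t \<beta>s \<alpha> \<beta>] isometric_quad_pfister_scale[of s \<beta>s \<alpha> 1]
      by (auto simp: R_def st)
    then have "isometric (quad_pfister (\<beta> # \<beta>s) \<alpha>) (quad_pfister (1 # \<beta>s) \<alpha>)"
      using isometric_trans isometric_sym by blast
    then show ?thesis
      using hyperbolic_quad_pfister_1[OF two \<beta>(2)] by (rule hyperbolic_isometric)
  qed
qed

subsection \<open>Linkage\<close>

lemma zero_append_vec: "0\<^sub>v a @\<^sub>v 0\<^sub>v b = 0\<^sub>v (a + b)"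
  by (intro eq_vecI) auto

lemma unit_vec_append:
  assumes "i < a"
  shows "unit_vec (a + b) i = unit_vec a i @\<^sub>v (0\<^sub>v b :: 'a::comm_ring_1 vec)"
  using assms by (intro eq_vecI) auto

text \<open>This vector serves twice: in \<rho> it spans the summand \<langle>1\<rangle> of the
  relation, and in b \<otimes> [1, a] it gives the vector on which b is 1.\<close>

lemma quad_pfister_unit_vec:
  "quad_eval (quad_pfister \<beta>s \<alpha>) (unit_vec (2 ^ Suc (length \<beta>s)) 0) = (1 :: 'a::field)"
proof (induction \<beta>s)
  case Nil
  have "unit_vec 2 0 = (vec_of_list [1, 0] :: 'a vec)"
    by (intro eq_vecI) (auto simp: less_Suc_eq numeral_2_eq_2 vec_of_list_index)
  then show ?case by (simp add: quad_pfister_Nil quad_eval_binary_form)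
next
  case (Cons \<beta> \<beta>s)
  let ?n = "2 ^ Suc (length \<beta>s)"
  note R = quad_pfister_carrier[of \<beta>s \<alpha>]
  have "unit_vec (2 ^ Suc (length (\<beta> # \<beta>s))) 0 = unit_vec ?n 0 @\<^sub>v (0\<^sub>v ?n :: 'a vec)"
    using unit_vec_append[of 0 ?n ?n] by (simp add: mult_2)
  with Cons show ?case
    by (simp del: power_Suc add: quad_pfister_osum quad_eval_osum[OF R smult_carrier_mat[OF R]]
        quad_eval_zero[OF smult_carrier_mat[OF R]])
qed

text \<open>The polar form of [1, \<alpha>] is a d + b c in characteristic 2, whatever \<alpha> is.
  A further slot adds a copy scaled by a nonzero \<beta>, and testing against vectors supported in
  one block separates the copies.\<close>

lemma quad_pfister_nondegenerate:
  fixes \<beta>s :: "'a::field list"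
  assumes two: "CHAR('a) = 2" and "0 \<notin> set \<beta>s"
    and "x \<in> carrier_vec (2 ^ Suc (length \<beta>s))"
    and "\<And>y. y \<in> carrier_vec (2 ^ Suc (length \<beta>s)) \<Longrightarrow> polar (quad_pfister \<beta>s \<alpha>) x y = 0"
  shows "x = 0\<^sub>v (2 ^ Suc (length \<beta>s))"
  using assms(2-)
proof (induction \<beta>s arbitrary: x)
  case Nil
  then obtain a b where x: "x = vec_of_list [a, b]" by (auto elim: carrier_vec2E)
  have polar: "polar (binary_form 1 \<alpha>) (vec_of_list [a, b]) (vec_of_list [c, d]) = a * d + b * c" for c d
  proof -
    have "vec_of_list [a, b] + vec_of_list [c, d] = vec_of_list [a + c, b + d]"
      by (intro eq_vecI) (auto simp: less_Suc_eq numeral_eq_Suc vec_of_list_index)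
    moreover have "(a + c)\<^sup>2 + (a + c) * (b + d) + \<alpha> * (b + d)\<^sup>2 =
        (a\<^sup>2 + a * b + \<alpha> * b\<^sup>2) + (c\<^sup>2 + c * d + \<alpha> * d\<^sup>2) + (a * d + b * c) + 2 * (a * c + \<alpha> * b * d)"
      by (simp add: algebra_simps power2_eq_square)
    ultimately show ?thesis
      using quad_eval_add[OF binary_form_carrier, of "vec_of_list [a, b]" "vec_of_list [c, d]" 1 \<alpha>]
      by (simp add: quad_eval_binary_form carrier_vecI char2_mult_2[OF two])
  qed
  have "polar (binary_form 1 \<alpha>) x (vec_of_list [0, 1]) = 0"
    "polar (binary_form 1 \<alpha>) x (vec_of_list [1, 0]) = 0"
    using Nil(3)[of "vec_of_list [0, 1]"] Nil(3)[of "vec_of_list [1, 0]"]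
    by (simp_all add: quad_pfister_Nil carrier_vecI)
  then show ?case
    unfolding x polar by (intro eq_vecI) (auto simp: less_Suc_eq numeral_2_eq_2 vec_of_list_index)
next
  case (Cons \<beta> \<beta>s)
  let ?n = "2 ^ Suc (length \<beta>s)"
  define R where "R = quad_pfister \<beta>s \<alpha>"
  have R: "R \<in> carrier_mat ?n ?n" unfolding R_def by (rule quad_pfister_carrier)
  have \<beta>: "\<beta> \<noteq> 0" "0 \<notin> set \<beta>s" using Cons.prems by auto
  define y z where "y = vec_first x ?n" and "z = vec_last x ?n"
  have x: "x = y @\<^sub>v z" and yz: "y \<in> carrier_vec ?n" "z \<in> carrier_vec ?n"
    using Cons.prems(2) by (simp_all add: y_def z_def mult_2)
  have polar: "polar R y u + polar (\<beta> \<cdot>\<^sub>m R) z v = 0" if "u \<in> carrier_vec ?n" "v \<in> carrier_vec ?n" for u v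
    using Cons.prems(3)[of "u @\<^sub>v v"] append_carrier_vec[OF that] that yz
      polar_osum[OF R smult_carrier_mat[OF R] yz that]
    by (simp add: x quad_pfister_osum R_def mult_2)
  have smult: "polar (\<beta> \<cdot>\<^sub>m R) z v = \<beta> * polar R z v" if "v \<in> carrier_vec ?n" for v
  proof -
    have "(\<beta> \<cdot>\<^sub>m R) *\<^sub>v u = \<beta> \<cdot>\<^sub>v (R *\<^sub>v u)" if "u \<in> carrier_vec ?n" for u
      using R that by (intro eq_vecI) auto
    then show ?thesis using that yz R by (simp add: polar_def algebra_simps)
  qed
  have "y = 0\<^sub>v ?n"
    using polar[of _ "0\<^sub>v ?n"] yz \<beta> R
    by (intro Cons.IH) (auto simp: R_def[symmetric] smult polar_zero[of _ ?n] simp del: power_Suc)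
  moreover have "z = 0\<^sub>v ?n"
    using polar[of "0\<^sub>v ?n"] yz \<beta> R
    by (intro Cons.IH) (auto simp: R_def[symmetric] smult polar_zero[of _ ?n] simp del: power_Suc)
  ultimately show ?case by (simp add: x zero_append_vec mult_2)
qed

text \<open>
  This says that \<open>\<langle>1\<rangle> \<bottom> \<beta>\<rho> \<bottom> \<gamma>\<rho>\<close> is isotropic (in characteristic 2), where \<open>\<rho>\<close> is the form of \<open>R\<close>.
\<close>

definition square_relation :: "'a::field mat \<Rightarrow> 'a \<Rightarrow> 'a \<Rightarrow> bool" where
  "square_relation R \<beta> \<gamma> \<longleftrightarrow>
     (\<exists>t. \<exists>y \<in> carrier_vec (dim_row R). \<exists>z \<in> carrier_vec (dim_row R).
        (t \<noteq> 0 \<or> y \<noteq> 0\<^sub>v (dim_row R) \<or> z \<noteq> 0\<^sub>v (dim_row R)) \<and>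
        t\<^sup>2 = \<beta> * quad_eval R y + \<gamma> * quad_eval R z)"

text \<open>The blocks of \<pi> are \<rho>, \<beta>\<rho>, \<gamma>\<rho>, \<gamma>\<beta>\<rho>.
  The form \<langle>1\<rangle> \<bottom> \<beta>\<rho> \<bottom> \<gamma>\<rho> is embedded with the
  first block restricted to a line and the last one zero.\<close>

lemma quad_eval_quad_pfister_Cons2:
  fixes \<beta> \<gamma> :: "'a::field"
  assumes n_def: "n = 2 ^ Suc (length \<beta>s)"
    and y: "y \<in> carrier_vec n" and z: "z \<in> carrier_vec n"
  shows "quad_eval (quad_pfister (\<gamma> # \<beta> # \<beta>s) \<alpha>) ((t \<cdot>\<^sub>v unit_vec n 0 @\<^sub>v y) @\<^sub>v (z @\<^sub>v 0\<^sub>v n)) =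
    t\<^sup>2 + \<beta> * quad_eval (quad_pfister \<beta>s \<alpha>) y + \<gamma> * quad_eval (quad_pfister \<beta>s \<alpha>) z"
proof -
  define R where "R = quad_pfister \<beta>s \<alpha>"
  have R: "R \<in> carrier_mat n n" unfolding R_def n_def by (rule quad_pfister_carrier)
  note cR = smult_carrier_mat[OF R]
  note T = osum_carrier[OF R cR] and cT = smult_carrier_mat[OF osum_carrier[OF R cR]]
  have unit: "quad_eval R (t \<cdot>\<^sub>v unit_vec n 0) = t\<^sup>2"
    using quad_eval_smult_vec[OF R, of "unit_vec n 0"] quad_pfister_unit_vec[of \<beta>s \<alpha>]
    by (simp add: R_def n_def)
  show ?thesis
    using y z unit unfolding quad_pfister_osum R_def[symmetric]
    by (simp add: quad_eval_osum[OF T cT] quad_eval_osum[OF R cR] quad_eval_smult_mat[OF T]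
        quad_eval_smult_mat[OF R] quad_eval_zero[OF R])
qed

lemma square_relation_imp_hyperbolic:
  fixes \<beta> \<gamma> :: "'a::field"
  assumes two: "CHAR('a) = 2" and "\<beta> \<noteq> 0" "\<gamma> \<noteq> 0" "0 \<notin> set \<beta>s"
    and rel: "square_relation (quad_pfister \<beta>s \<alpha>) \<beta> \<gamma>"
  shows "hyperbolic (quad_pfister (\<gamma> # \<beta> # \<beta>s) \<alpha>)"
proof -
  define n :: nat where "n = 2 ^ Suc (length \<beta>s)"
  have n: "dim_row (quad_pfister \<beta>s \<alpha>) = n" "0 < n"
    using quad_pfister_carrier[of \<beta>s \<alpha>] by (auto simp: n_def)
  from rel obtain t y z where yz: "y \<in> carrier_vec n" "z \<in> carrier_vec n"
    and nonzero: "t \<noteq> 0 \<or> y \<noteq> 0\<^sub>v n \<or> z \<noteq> 0\<^sub>v n"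
    and eq: "t\<^sup>2 = \<beta> * quad_eval (quad_pfister \<beta>s \<alpha>) y + \<gamma> * quad_eval (quad_pfister \<beta>s \<alpha>) z"
    unfolding square_relation_def n by auto
  define x where "x = (t \<cdot>\<^sub>v unit_vec n 0 @\<^sub>v y) @\<^sub>v (z @\<^sub>v 0\<^sub>v n)"
  have "x \<in> carrier_vec ((n + n) + (n + n))"
    unfolding x_def using yz by (intro append_carrier_vec) auto
  then have x: "x \<in> carrier_vec (2 ^ Suc (length (\<gamma> # \<beta> # \<beta>s)))"
    by (simp add: n_def)
  show ?thesis
  proof (rule isotropic_imp_hyperbolic[OF two _ x])
    show "quad_eval (quad_pfister (\<gamma> # \<beta> # \<beta>s) \<alpha>) x = 0"
      using quad_eval_quad_pfister_Cons2[OF n_def yz, of \<gamma> \<beta> \<alpha> t] eq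
        char2_add_self[OF two, of "t\<^sup>2"]
      by (simp add: x_def add.assoc)
    show "x \<noteq> 0\<^sub>v (2 ^ Suc (length (\<gamma> # \<beta> # \<beta>s)))"
    proof
      assume "x = 0\<^sub>v (2 ^ Suc (length (\<gamma> # \<beta> # \<beta>s)))"
      also have "\<dots> = (0\<^sub>v n @\<^sub>v 0\<^sub>v n) @\<^sub>v (0\<^sub>v n @\<^sub>v 0\<^sub>v n)"
        by (simp add: zero_append_vec n_def)
      finally have "t \<cdot>\<^sub>v unit_vec n 0 @\<^sub>v y = 0\<^sub>v n @\<^sub>v 0\<^sub>v n \<and> z @\<^sub>v 0\<^sub>v n = 0\<^sub>v n @\<^sub>v (0\<^sub>v n :: 'a vec)"
        unfolding x_def by (subst (asm) append_vec_eq[of _ "n + n"]) (use yz in auto)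
      then have *: "t \<cdot>\<^sub>v unit_vec n 0 = 0\<^sub>v n" "y = 0\<^sub>v n" "z = 0\<^sub>v n"
        using yz by (simp_all add: append_vec_eq[of _ n])
      from arg_cong[OF *(1), of "\<lambda>v. v $ 0"] n have "t = 0" by simp
      with * nonzero show False by simp
    qed
  qed (use assms in auto)
qed

text \<open>One coordinate of each plane is set to 0; such vectors form a totally isotropic subspace
  of half the dimension.\<close>

lemma quad_eval_hyp_eq_0:
  fixes x :: "'a::field vec"
  assumes "x \<in> carrier_vec (2 * m)" "\<And>i. i < m \<Longrightarrow> x $ (2 * i) = 0"
  shows "quad_eval (hyp m) x = 0"
  using assms
proof (induction m arbitrary: x)
  case 0
  then show ?case by (simp add: quad_eval_def scalar_prod_def)
next
  case (Suc m)
  define y z where "y = vec_first x 2" and "z = vec_last x (2 * m)"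
  have x: "x = y @\<^sub>v z" and y: "y \<in> carrier_vec 2" and z: "z \<in> carrier_vec (2 * m)"
    using Suc.prems(1) by (simp_all add: y_def z_def)
  from y obtain a b where ab: "y = vec_of_list [a, b]" by (rule carrier_vec2E)
  have "a = 0" using Suc.prems(2)[of 0] x y by (simp add: ab vec_of_list_index)
  moreover have "z $ (2 * i) = 0" if "i < m" for i
    using Suc.prems(2)[of "Suc i"] that x y z by simp
  then have "quad_eval (hyp m) z = 0" using Suc.IH[OF z] by blast
  ultimately show ?case
    unfolding hyp_Suc x quad_eval_osum[OF binary_form_carrier hyp_carrier y z]
    by (simp add: ab quad_eval_binary_form)
qed

text \<open>Here n is the dimension of \<rho>. The vector w packs t, y and z into 2 n + 1 unknowns,
  and lying in the totally isotropic subspace of the 2 n hyperbolic planes imposes 2 n linear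
  equations, so there is a nonzero solution.\<close>

lemma hyperbolic_imp_square_relation:
  fixes \<beta> \<gamma> :: "'a::field"
  assumes two: "CHAR('a) = 2" and hyp: "hyperbolic (quad_pfister (\<gamma> # \<beta> # \<beta>s) \<alpha>)"
  shows "square_relation (quad_pfister \<beta>s \<alpha>) \<beta> \<gamma>"
proof -
  define n :: nat where "n = 2 ^ Suc (length \<beta>s)"
  have n: "dim_row (quad_pfister \<beta>s \<alpha>) = n" "0 < n"
    using quad_pfister_carrier[of \<beta>s \<alpha>] by (auto simp: n_def)
  let ?N = "(n + n) + (n + n)"
  have T: "quad_pfister (\<gamma> # \<beta> # \<beta>s) \<alpha> \<in> carrier_mat ?N ?N"
    using quad_pfister_carrier[of "\<gamma> # \<beta> # \<beta>s" \<alpha>] by (simp add: n_def)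
  from hyp obtain m where m: "isometric (quad_pfister (\<gamma> # \<beta> # \<beta>s) \<alpha>) (hyp m)"
    unfolding hyperbolic_def by auto
  from isometricE[OF m T] obtain P where H: "(hyp m :: 'a mat) \<in> carrier_mat ?N ?N"
    and P: "P \<in> carrier_mat ?N ?N"
    and eval: "\<And>x. x \<in> carrier_vec ?N \<Longrightarrow>
      quad_eval (hyp m) (P *\<^sub>v x) = quad_eval (quad_pfister (\<gamma> # \<beta> # \<beta>s) \<alpha>) x" by metis
  have m_eq: "m = n + n"
    using carrier_matD(1)[OF H] carrier_matD(1)[OF hyp_carrier[where 'a = 'a, of m]] by simp
  define y z where "y w = vec n (\<lambda>i. w $ Suc i)" and "z w = vec n (\<lambda>i. w $ Suc (n + i))" for w :: "'a vec"
  define x where "x w = (w $ 0 \<cdot>\<^sub>v unit_vec n 0 @\<^sub>v y w) @\<^sub>v (z w @\<^sub>v 0\<^sub>v n)" for w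
  have x: "x w \<in> carrier_vec ?N" for w
    unfolding x_def by (intro append_carrier_vec) (auto simp: y_def z_def)
  have x_add: "x (u + v) = x u + x v" if "u \<in> carrier_vec (Suc (n + n))" "v \<in> carrier_vec (Suc (n + n))" for u v
    using that by (intro eq_vecI) (auto simp: x_def y_def z_def algebra_simps)
  have x_smult: "x (c \<cdot>\<^sub>v u) = c \<cdot>\<^sub>v x u" if "u \<in> carrier_vec (Suc (n + n))" for c u
    using that by (intro eq_vecI) (auto simp: x_def y_def z_def)
  define f where "f w = vec m (\<lambda>i. (P *\<^sub>v x w) $ (2 * i))" for w
  obtain F where F: "F \<in> carrier_mat m (Suc (n + n))"
    "\<And>w. w \<in> carrier_vec (Suc (n + n)) \<Longrightarrow> f w = F *\<^sub>v w"
  proof (rule linear_map_matrix)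
    show "f w \<in> carrier_vec m" for w by (simp add: f_def)
    show "f (u + v) = f u + f v" if "u \<in> carrier_vec (Suc (n + n))" "v \<in> carrier_vec (Suc (n + n))" for u v
      using P x[of u] x[of v] that
      by (intro eq_vecI) (auto simp: f_def x_add mult_add_distrib_mat_vec[OF P x x] m_eq
          simp del: index_mult_mat_vec)
    show "f (c \<cdot>\<^sub>v u) = c \<cdot>\<^sub>v f u" if "u \<in> carrier_vec (Suc (n + n))" for c u
      using P x[of u] that
      by (intro eq_vecI) (auto simp: f_def x_smult mult_mat_vec[OF P x] m_eq
          simp del: index_mult_mat_vec)
  qed blast
  from underdetermined_system[OF F(1)] obtain w where w: "w \<in> carrier_vec (Suc (n + n))"
    "w \<noteq> 0\<^sub>v (Suc (n + n))" "f w = 0\<^sub>v m"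
    using F(2) by (auto simp: m_eq)
  have "quad_eval (hyp m) (P *\<^sub>v x w) = 0"
  proof (rule quad_eval_hyp_eq_0)
    show "P *\<^sub>v x w \<in> carrier_vec (2 * m)" using carrier_matD(1)[OF P] by (intro carrier_vecI) (simp add: m_eq)
    show "(P *\<^sub>v x w) $ (2 * i) = 0" if "i < m" for i
      using arg_cong[OF w(3), of "\<lambda>v. v $ i"] that by (simp add: f_def del: index_mult_mat_vec)
  qed
  then have "(w $ 0)\<^sup>2 + (\<beta> * quad_eval (quad_pfister \<beta>s \<alpha>) (y w) + \<gamma> * quad_eval (quad_pfister \<beta>s \<alpha>) (z w)) = 0"
    using eval[OF x] quad_eval_quad_pfister_Cons2[OF n_def, of "y w" "z w" \<gamma> \<beta> \<alpha> "w $ 0"]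
    by (simp add: x_def y_def z_def add.assoc)
  then have "(w $ 0)\<^sup>2 = \<beta> * quad_eval (quad_pfister \<beta>s \<alpha>) (y w) + \<gamma> * quad_eval (quad_pfister \<beta>s \<alpha>) (z w)"
    using char2_minus[OF two, of "(w $ 0)\<^sup>2"] by (metis eq_iff_diff_eq_0)
  moreover have "w $ 0 \<noteq> 0 \<or> y w \<noteq> 0\<^sub>v n \<or> z w \<noteq> 0\<^sub>v n"
  proof (rule ccontr)
    assume "\<not> ?thesis"
    then have *: "w $ 0 = 0" "\<And>i. i < n \<Longrightarrow> y w $ i = 0" "\<And>i. i < n \<Longrightarrow> z w $ i = 0" by auto
    have "w $ i = 0" if "i < Suc (n + n)" for i
    proof (cases i)
      case (Suc j)
      then show ?thesis
        using that *(2)[of j] *(3)[of "j - n"] by (cases "j < n") (auto simp: y_def z_def)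
    qed (use * in simp)
    then have "w = 0\<^sub>v (Suc (n + n))" using w(1) by (intro eq_vecI) auto
    with w show False by simp
  qed
  ultimately show ?thesis
    unfolding square_relation_def n
    by (intro exI[of _ "w $ 0"] bexI[of _ "y w"] bexI[of _ "z w"]) (auto simp: y_def z_def)
qed

section \<open>From a relation to left linkage\<close>

lemma left_linked_pair:
  "left_linked n {A, A'} \<longleftrightarrow>
     (\<exists>\<beta>s a a'. length \<beta>s = n - 1 \<and> 0 \<notin> set \<beta>s \<and>
        isometric A (quad_pfister \<beta>s a) \<and> isometric A' (quad_pfister \<beta>s a'))"
  unfolding left_linked_def is_bil_pfister_def quad_pfister_def by auto

lemma square_relation_imp_left_linked:
  fixes \<beta> \<gamma> :: "'a::field"
  assumes two: "CHAR('a) = 2" and \<beta>: "\<beta> \<noteq> 0" and \<gamma>: "\<gamma> \<noteq> 0" and \<beta>s: "0 \<notin> set \<beta>s"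
    and rel: "square_relation (quad_pfister \<beta>s \<alpha>) \<beta> \<gamma>"
  shows "left_linked (length \<beta>s + 2) {quad_pfister (\<beta> # \<beta>s) \<alpha>, quad_pfister (\<gamma> # \<beta>s) \<alpha>}"
proof -
  define n :: nat where "n = 2 ^ Suc (length \<beta>s)"
  define R where "R = quad_pfister \<beta>s \<alpha>"
  have R: "R \<in> carrier_mat n n" unfolding R_def n_def by (rule quad_pfister_carrier)
  have linked: ?thesis
    if "\<delta> \<noteq> 0" "isometric (quad_pfister (\<beta> # \<beta>s) \<alpha>) (quad_pfister (\<delta> # \<beta>s) a)"
      "isometric (quad_pfister (\<gamma> # \<beta>s) \<alpha>) (quad_pfister (\<delta> # \<beta>s) a')" for \<delta> a a'
    unfolding left_linked_pair using that \<beta>s by (intro exI[of _ "\<delta> # \<beta>s"]) auto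
  have refl: "isometric (quad_pfister (b # \<beta>s) \<alpha>) (quad_pfister (b # \<beta>s) \<alpha>)" for b
    by (rule isometric_refl[OF quad_pfister_carrier])
  \<comment> \<open>If one of the two forms is hyperbolic, it can take over the bilinear slots of
    the other, and linkage follows without the relation.\<close>
  have to_hyp: "isometric (quad_pfister (b # \<beta>s) \<alpha>) (quad_pfister (c # \<beta>s) 0)"
    if "hyperbolic (quad_pfister (b # \<beta>s) \<alpha>)" "c \<noteq> 0" for b c
    using that \<beta>s quad_pfister_carrier[of "b # \<beta>s" \<alpha>] quad_pfister_carrier[of "c # \<beta>s" 0]
    by (intro isometric_hyperbolic[OF that(1) hyperbolic_quad_pfister_0]) auto
  show ?thesis
  proof (cases "hyperbolic (quad_pfister (\<beta> # \<beta>s) \<alpha>) \<or> hyperbolic (quad_pfister (\<gamma> # \<beta>s) \<alpha>)")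
    case True
    then show ?thesis
      using linked[OF \<gamma> to_hyp refl] linked[OF \<beta> refl to_hyp] \<beta> \<gamma> by blast
  next
    case False
    have aniso: "quad_eval R y \<noteq> 0" if "y \<in> carrier_vec n" "y \<noteq> 0\<^sub>v n" for y
    proof
      assume "quad_eval R y = 0"
      then have "hyperbolic R"
        using that isotropic_imp_hyperbolic[OF two \<beta>s] unfolding R_def n_def by blast
      with False \<beta> show False
        using hyperbolic_quad_pfister_Cons unfolding R_def by blast
    qed
    have scale: "isometric (quad_pfister (b # \<beta>s) \<alpha>) (quad_pfister ((b * quad_eval R y) # \<beta>s) \<alpha>)"
      if "y \<in> carrier_vec n" "quad_eval R y \<noteq> 0" for b y
      using quad_pfister_round[OF two \<beta>s] that unfolding R_def n_def
      by (intro isometric_quad_pfister_scale) blast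
    have not_1: "b * quad_eval R y \<noteq> 1"
      if "y \<in> carrier_vec n" "\<not> hyperbolic (quad_pfister (b # \<beta>s) \<alpha>)" for b y
    proof
      assume "b * quad_eval R y = 1"
      moreover from this have "quad_eval R y \<noteq> 0" by auto
      ultimately have "isometric (quad_pfister (b # \<beta>s) \<alpha>) (quad_pfister (1 # \<beta>s) \<alpha>)"
        using scale[OF that(1), of b] by simp
      with that(2) hyperbolic_quad_pfister_1[OF two \<beta>s] show False
        using hyperbolic_isometric by blast
    qed
    from rel obtain t y z where yz: "y \<in> carrier_vec n" "z \<in> carrier_vec n"
      and nonzero: "t \<noteq> 0 \<or> y \<noteq> 0\<^sub>v n \<or> z \<noteq> 0\<^sub>v n"
      and eq: "t\<^sup>2 = \<beta> * quad_eval R y + \<gamma> * quad_eval R z"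
      using R unfolding square_relation_def R_def[symmetric] by auto
    show ?thesis
    proof (cases "t = 0")
      case True
      then have "\<beta> * quad_eval R y - \<gamma> * quad_eval R z = 0"
        unfolding char2_minus[OF two] using eq True by simp
      \<comment> \<open>By roundness this common value can replace both \<beta> and \<gamma>, so the
        two forms are even isometric.\<close>
      then have eq: "\<gamma> * quad_eval R z = \<beta> * quad_eval R y" by simp
      have "quad_eval R y \<noteq> 0 \<or> quad_eval R z \<noteq> 0"
        using nonzero True aniso yz by auto
      then have "quad_eval R y \<noteq> 0" "quad_eval R z \<noteq> 0" using eq \<beta> \<gamma> by auto
      then show ?thesis
        using linked[of "\<beta> * quad_eval R y"] scale[OF yz(1), of \<beta>] scale[OF yz(2), of \<gamma>] \<beta> eq by auto
    next
      case t: False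
      \<comment> \<open>Dividing by t normalises the relation to 1 = \<beta>\<rho>(y') +
        \<gamma>\<rho>(z').\<close>
      define y' z' where "y' = (1 / t) \<cdot>\<^sub>v y" and "z' = (1 / t) \<cdot>\<^sub>v z"
      have yz': "y' \<in> carrier_vec n" "z' \<in> carrier_vec n" using yz by (auto simp: y'_def z'_def)
      define \<delta> where "\<delta> = \<beta> * quad_eval R y'"
      have "\<delta> + \<gamma> * quad_eval R z' = (\<beta> * quad_eval R y + \<gamma> * quad_eval R z) / t\<^sup>2"
        unfolding \<delta>_def y'_def z'_def quad_eval_smult_vec[OF R yz(1)] quad_eval_smult_vec[OF R yz(2)]
        by (simp add: power_divide add_divide_distrib)
      also have "\<dots> = 1" using t by (simp add: eq[symmetric])
      finally have "\<gamma> * quad_eval R z' = 1 - \<delta>" by (simp add: algebra_simps)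
      then have \<gamma>z: "\<gamma> * quad_eval R z' = 1 + \<delta>" by (simp add: char2_minus[OF two])
      \<comment> \<open>A slot that can be changed to 1 would make one of the forms hyperbolic. In
        characteristic 2 the two inequalities are the conditions of
        \<open>isometric_quad_pfister_shift\<close>.\<close>
      have "\<delta> \<noteq> 1" "1 + \<delta> \<noteq> 1"
        using not_1[OF yz'(1), of \<beta>] not_1[OF yz'(2), of \<gamma>] False \<gamma>z by (auto simp: \<delta>_def)
      then have \<delta>: "\<delta> \<noteq> 0" "1 + \<delta> \<noteq> 0"
        using char2_minus[OF two, of 1 \<delta>] by (metis add.right_neutral, metis eq_iff_diff_eq_0)
      have "isometric (quad_pfister (\<beta> # \<beta>s) \<alpha>) (quad_pfister (\<delta> # \<beta>s) \<alpha>)"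
        using scale[OF yz'(1), of \<beta>] \<delta>(1) by (auto simp: \<delta>_def)
      moreover have "isometric (quad_pfister (\<gamma> # \<beta>s) \<alpha>) (quad_pfister ((1 + \<delta>) # \<beta>s) \<alpha>)"
        using scale[OF yz'(2), of \<gamma>] \<delta>(2) \<gamma>z by fastforce
      ultimately show ?thesis
        using linked[OF \<delta>(1)] isometric_trans[OF _ isometric_quad_pfister_shift[OF two \<delta>]] by blast
    qed
  qed
qed

section \<open>From left linkage to a relation\<close>

definition spread :: "'a::zero vec \<Rightarrow> 'a vec" where
  "spread v = vec (2 * dim_vec v) (\<lambda>i. if even i then v $ (i div 2) else 0)"

lemma spread_carrier [simp]: "v \<in> carrier_vec n \<Longrightarrow> spread v \<in> carrier_vec (2 * n)"
  by (simp add: spread_def)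

lemma spread_add:
  fixes v w :: "'a::comm_ring_1 vec"
  assumes "v \<in> carrier_vec n" "w \<in> carrier_vec n"
  shows "spread (v + w) = spread v + spread w"
  using assms by (intro eq_vecI) (auto simp: spread_def)

lemma spread_smult:
  fixes v :: "'a::comm_ring_1 vec"
  shows "spread (c \<cdot>\<^sub>v v) = c \<cdot>\<^sub>v spread v"
  by (intro eq_vecI) (auto simp: spread_def)

lemma spread_append: "spread (v @\<^sub>v w) = spread v @\<^sub>v (spread w :: 'a::zero vec)"
  by (intro eq_vecI) (auto simp: spread_def diff_mult_distrib2[symmetric] elim!: evenE)

lemma spread_unit_vec:
  assumes "0 < n"
  shows "spread (unit_vec n 0) = (unit_vec (2 * n) 0 :: 'a::comm_ring_1 vec)"
  using assms by (intro eq_vecI) (auto simp: spread_def elim!: evenE)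

lemma spread_eq_0:
  assumes "v \<in> carrier_vec n" "spread v = (0\<^sub>v (2 * n) :: 'a::zero vec)"
  shows "v = 0\<^sub>v n"
proof (rule eq_vecI)
  fix i assume "i < dim_vec (0\<^sub>v n)"
  then show "v $ i = 0\<^sub>v n $ i"
    using arg_cong[OF assms(2), of "\<lambda>u. u $ (2 * i)"] assms(1) by (simp add: spread_def)
qed (use assms in auto)

text \<open>The vector \<open>spread v\<close> is \<open>v \<otimes> e\<^sub>1\<close>, where \<open>b \<otimes> [1, a]\<close> takes the value \<open>b(v, v)\<close>.\<close>

lemma quad_pfister_spread:
  fixes \<beta>s :: "'a::field list"
  assumes two: "CHAR('a) = 2"
    and "v \<in> carrier_vec (2 ^ length \<beta>s)" "w \<in> carrier_vec (2 ^ length \<beta>s)"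
  shows "quad_eval (quad_pfister \<beta>s a) (spread v) = quad_eval (quad_pfister \<beta>s a') (spread v) \<and>
    quad_eval (quad_pfister \<beta>s a) (spread (v + w)) =
      quad_eval (quad_pfister \<beta>s a) (spread v) + quad_eval (quad_pfister \<beta>s a) (spread w)"
  using assms(2-)
proof (induction \<beta>s arbitrary: v w)
  case Nil
  have spread: "spread u = vec_of_list [u $ 0, 0]" if "u \<in> carrier_vec 1" for u :: "'a vec"
    using that by (intro eq_vecI)
      (auto simp: spread_def less_Suc_eq numeral_2_eq_2 vec_of_list_index)
  have eval: "quad_eval (quad_pfister [] c) (spread u) = (u $ 0)\<^sup>2" if "u \<in> carrier_vec 1" for u :: "'a vec" and c
    unfolding quad_pfister_Nil spread[OF that] quad_eval_binary_form by simp
  have "(v $ 0 + w $ 0)\<^sup>2 = (v $ 0)\<^sup>2 + (w $ 0)\<^sup>2 + 2 * (v $ 0 * w $ 0)"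
    by (simp add: algebra_simps power2_eq_square)
  with Nil show ?case by (simp add: eval char2_mult_2[OF two])
next
  case (Cons \<beta> \<beta>s)
  let ?n = "2 ^ length \<beta>s"
  note R = quad_pfister_carrier[of \<beta>s, folded power_Suc]
  have eval: "quad_eval (quad_pfister (\<beta> # \<beta>s) c) (spread (x @\<^sub>v y)) =
      quad_eval (quad_pfister \<beta>s c) (spread x) + \<beta> * quad_eval (quad_pfister \<beta>s c) (spread y)"
    if "x \<in> carrier_vec ?n" "y \<in> carrier_vec ?n" for x y c
    using that R[of c] unfolding spread_append quad_pfister_osum
    by (subst quad_eval_osum[OF R smult_carrier_mat[OF R]]) (auto simp: quad_eval_smult_mat[OF R])
  define x y where "x = vec_first v ?n" and "y = vec_last v ?n"
  have v: "v = x @\<^sub>v y" and xy: "x \<in> carrier_vec ?n" "y \<in> carrier_vec ?n"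
    using Cons.prems(1) by (simp_all add: x_def y_def mult_2)
  define x' y' where "x' = vec_first w ?n" and "y' = vec_last w ?n"
  have w: "w = x' @\<^sub>v y'" and xy': "x' \<in> carrier_vec ?n" "y' \<in> carrier_vec ?n"
    using Cons.prems(2) by (simp_all add: x'_def y'_def mult_2)
  have vw: "v + w = (x + x') @\<^sub>v (y + y')"
    unfolding v w using append_vec_add[OF xy(1) xy'(1) xy(2) xy'(2)] by simp
  show ?case
    using Cons.IH[OF xy(1) xy'(1)] Cons.IH[OF xy(2) xy'(2)] xy xy'
    unfolding vw by (simp add: v w eval algebra_simps)
qed

text \<open>X v and Z v are the components in \<rho> and \<beta>\<rho> of the image of v \<otimes>
  e_1. The matrices are square because b and \<rho> have the same dimension. The polar form vanishes
  on all images since b \<otimes> \<langle>1\<rangle> is totally singular; if Z v = 0, only its part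
  on \<rho> is left, which gives the second property. The third is injectivity of the
  isometry.\<close>

lemma isometric_spread_coordinates:
  fixes \<beta>s \<alpha>s :: "'a::field list" and \<alpha> :: 'a
  defines "R \<equiv> quad_pfister \<alpha>s \<alpha>"
  assumes two: "CHAR('a) = 2" and n: "n = 2 ^ length \<beta>s" and length: "length \<beta>s = Suc (length \<alpha>s)"
    and iso: "isometric (quad_pfister (\<beta> # \<alpha>s) \<alpha>) (quad_pfister \<beta>s a)"
  obtains X Z where "X \<in> carrier_mat n n" "Z \<in> carrier_mat n n"
    "\<And>v. v \<in> carrier_vec n \<Longrightarrow>
      quad_eval R (X *\<^sub>v v) + \<beta> * quad_eval R (Z *\<^sub>v v) = quad_eval (quad_pfister \<beta>s a) (spread v)"
    "\<And>v w. v \<in> carrier_vec n \<Longrightarrow> w \<in> carrier_vec n \<Longrightarrow> Z *\<^sub>v v = 0\<^sub>v n \<Longrightarrow>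
      polar R (X *\<^sub>v v) (X *\<^sub>v w) = 0"
    "\<And>v. v \<in> carrier_vec n \<Longrightarrow> X *\<^sub>v v = 0\<^sub>v n \<Longrightarrow> Z *\<^sub>v v = 0\<^sub>v n \<Longrightarrow> v = 0\<^sub>v n"
proof -
  have R: "R \<in> carrier_mat n n"
    unfolding R_def using quad_pfister_carrier[of \<alpha>s \<alpha>] by (simp add: n length)
  have T_eq: "quad_pfister (\<beta> # \<alpha>s) \<alpha> = osum R (\<beta> \<cdot>\<^sub>m R)"
    unfolding R_def by (rule quad_pfister_osum)
  have T: "quad_pfister (\<beta> # \<alpha>s) \<alpha> \<in> carrier_mat (n + n) (n + n)"
    unfolding T_eq by (rule osum_carrier[OF R smult_carrier_mat[OF R]])
  from isometricE[OF iso T] obtain P P' where D: "quad_pfister \<beta>s a \<in> carrier_mat (n + n) (n + n)"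
    and P: "P \<in> carrier_mat (n + n) (n + n)" "P' \<in> carrier_mat (n + n) (n + n)" "P' * P = 1\<^sub>m (n + n)"
    and eval: "\<And>x. x \<in> carrier_vec (n + n) \<Longrightarrow>
      quad_eval (quad_pfister (\<beta> # \<alpha>s) \<alpha>) (P *\<^sub>v x) = quad_eval (quad_pfister \<beta>s a) x" by metis
  define f where "f v = P *\<^sub>v spread v" for v
  have spread: "spread v \<in> carrier_vec (n + n)" if "v \<in> carrier_vec n" for v :: "'a vec"
    using spread_carrier[OF that] by (simp add: mult_2)
  have f: "f v \<in> carrier_vec (n + n)" if "v \<in> carrier_vec n" for v
    using P spread[OF that] by (simp add: f_def)
  have f_add: "f (v + w) = f v + f w" if "v \<in> carrier_vec n" "w \<in> carrier_vec n" for v w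
    unfolding f_def spread_add[OF that] by (rule mult_add_distrib_mat_vec[OF P(1) spread[OF that(1)] spread[OF that(2)]])
  have f_smult: "f (c \<cdot>\<^sub>v v) = c \<cdot>\<^sub>v f v" if "v \<in> carrier_vec n" for c v
    unfolding f_def spread_smult by (rule mult_mat_vec[OF P(1) spread[OF that]])
  obtain X where X: "X \<in> carrier_mat n n"
    "\<And>v. v \<in> carrier_vec n \<Longrightarrow> vec_first (f v) n = X *\<^sub>v v"
  proof (rule linear_map_matrix[of n "\<lambda>v. vec_first (f v) n" n])
    show "vec_first (f (v + w)) n = vec_first (f v) n + vec_first (f w) n"
      if "v \<in> carrier_vec n" "w \<in> carrier_vec n" for v w
      using f[OF that(1)] f[OF that(2)] by (intro eq_vecI) (auto simp: f_add[OF that] vec_first_def)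
    show "vec_first (f (c \<cdot>\<^sub>v v)) n = c \<cdot>\<^sub>v vec_first (f v) n" if "v \<in> carrier_vec n" for c v
      using f[OF that] by (intro eq_vecI) (auto simp: f_smult[OF that] vec_first_def)
  qed auto
  obtain Z where Z: "Z \<in> carrier_mat n n"
    "\<And>v. v \<in> carrier_vec n \<Longrightarrow> vec_last (f v) n = Z *\<^sub>v v"
  proof (rule linear_map_matrix[of n "\<lambda>v. vec_last (f v) n" n])
    show "vec_last (f (v + w)) n = vec_last (f v) n + vec_last (f w) n"
      if "v \<in> carrier_vec n" "w \<in> carrier_vec n" for v w
      using f[OF that(1)] f[OF that(2)] by (intro eq_vecI) (auto simp: f_add[OF that] vec_last_def)
    show "vec_last (f (c \<cdot>\<^sub>v v)) n = c \<cdot>\<^sub>v vec_last (f v) n" if "v \<in> carrier_vec n" for c v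
      using f[OF that] by (intro eq_vecI) (auto simp: f_smult[OF that] vec_last_def)
  qed auto
  have f_eq: "f v = X *\<^sub>v v @\<^sub>v Z *\<^sub>v v" if "v \<in> carrier_vec n" for v
    using vec_first_last_append[OF f[OF that]] X(2)[OF that] Z(2)[OF that] by simp
  have XZ: "X *\<^sub>v v \<in> carrier_vec n" "Z *\<^sub>v v \<in> carrier_vec n" if "v \<in> carrier_vec n" for v
    using X(1) Z(1) that by simp_all
  show thesis
  proof (rule that[OF X(1) Z(1)])
    fix v :: "'a vec" assume v: "v \<in> carrier_vec n"
    have "quad_eval (osum R (\<beta> \<cdot>\<^sub>m R)) (f v) = quad_eval (quad_pfister \<beta>s a) (spread v)"
      using eval[OF spread[OF v]] by (simp add: f_def T_eq)
    then show "quad_eval R (X *\<^sub>v v) + \<beta> * quad_eval R (Z *\<^sub>v v) =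
        quad_eval (quad_pfister \<beta>s a) (spread v)"
      by (simp add: f_eq[OF v] quad_eval_osum[OF R smult_carrier_mat[OF R] XZ[OF v]]
          quad_eval_smult_mat[OF R XZ(2)[OF v]])
    show "v = 0\<^sub>v n" if "X *\<^sub>v v = 0\<^sub>v n" "Z *\<^sub>v v = 0\<^sub>v n"
    proof -
      have "P *\<^sub>v spread v = 0\<^sub>v (n + n)"
        using f_eq[OF v] that by (simp add: f_def zero_append_vec)
      then have "P' * P *\<^sub>v spread v = 0\<^sub>v (n + n)"
        using P(1,2) spread[OF v] by (simp add: assoc_mult_mat_vec[of _ "n + n" "n + n"] mult_mat_zero_vec)
      then show ?thesis using P(3) spread[OF v] spread_eq_0[OF v] by (simp add: mult_2)
    qed
    fix w :: "'a vec" assume w: "w \<in> carrier_vec n" and Zv: "Z *\<^sub>v v = 0\<^sub>v n"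
    \<comment> \<open>The form is additive on vectors v \<otimes> e_1, and the failure of additivity
      is exactly the polar form.\<close>
    have "quad_eval (quad_pfister (\<beta> # \<alpha>s) \<alpha>) (f v + f w) =
        quad_eval (quad_pfister (\<beta> # \<alpha>s) \<alpha>) (f v) + quad_eval (quad_pfister (\<beta> # \<alpha>s) \<alpha>) (f w)"
      using quad_pfister_spread[OF two, of v \<beta>s w a a] v w n eval spread f_add[OF v w]
      by (metis f_def add_carrier_vec)
    then have "polar (osum R (\<beta> \<cdot>\<^sub>m R)) (f v) (f w) = 0"
      using quad_eval_add[OF T f[OF v] f[OF w]] by (simp add: T_eq)
    then show "polar R (X *\<^sub>v v) (X *\<^sub>v w) = 0"
      unfolding f_eq[OF v] f_eq[OF w] polar_osum[OF R smult_carrier_mat[OF R] XZ[OF v] XZ[OF w]]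
      by (simp add: Zv polar_zero[OF smult_carrier_mat[OF R] XZ(2)[OF w]])
  qed
qed

lemma polar_eq_scalar_prod:
  fixes A :: "'a::comm_ring_1 mat"
  assumes "A \<in> carrier_mat d d" "x \<in> carrier_vec d" "y \<in> carrier_vec d"
  shows "polar A x y = (A\<^sup>T *\<^sub>v x + A *\<^sub>v x) \<bullet> y"
proof -
  have "x \<bullet> (A *\<^sub>v y) = (A\<^sup>T *\<^sub>v x) \<bullet> y"
    using assms by (simp add: transpose_vec_mult_scalar[of A d d])
  moreover have "y \<bullet> (A *\<^sub>v x) = (A *\<^sub>v x) \<bullet> y"
    using assms by (intro comm_scalar_prod[of _ d]) auto
  ultimately show ?thesis
    using assms by (simp add: polar_def add_scalar_prod_distrib[of _ d])
qed

text \<open>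
  Let \<open>\<rho>\<close> be the form of \<open>quad_pfister \<alpha>s \<alpha>\<close>, and suppose that \<open>\<phi> = \<rho> \<bottom> \<beta>\<rho>\<close> and \<open>\<psi> = \<rho> \<bottom> \<gamma>\<rho>\<close> are
  \<open>b \<otimes> [1, a]\<close> and \<open>b \<otimes> [1, a']\<close>. Write \<open>(X v, Z v)\<close> and \<open>(Y v, Q v)\<close> for the vector \<open>v \<otimes> e\<^sub>1\<close> in the two
  decompositions. If \<open>X (v + t e\<^sub>0) = Y v\<close>, then \<open>\<beta>\<rho>(Z (v + t e\<^sub>0)) + \<gamma>\<rho>(Q v) = t\<^sup>2\<close>; if this never gives
  a nontrivial relation, then the pairing lemma applies to the linear maps
  \<open>(t, v) \<mapsto> X (v + t e\<^sub>0) - Y v\<close> and \<open>(t, v) \<mapsto> polar \<rho> (Y v)\<close>, and yields a contradiction.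
\<close>

lemma left_linked_imp_square_relation:
  fixes \<beta> \<gamma> :: "'a::field"
  assumes two: "CHAR('a) = 2" and \<alpha>s: "0 \<notin> set \<alpha>s"
    and linked: "left_linked (length \<alpha>s + 2) {quad_pfister (\<beta> # \<alpha>s) \<alpha>, quad_pfister (\<gamma> # \<alpha>s) \<alpha>}"
  shows "square_relation (quad_pfister \<alpha>s \<alpha>) \<beta> \<gamma>"
proof (rule ccontr)
  assume no_rel: "\<not> square_relation (quad_pfister \<alpha>s \<alpha>) \<beta> \<gamma>"
  from linked obtain \<beta>s a a' where length: "length \<beta>s = Suc (length \<alpha>s)"
    and iso: "isometric (quad_pfister (\<beta> # \<alpha>s) \<alpha>) (quad_pfister \<beta>s a)"
      "isometric (quad_pfister (\<gamma> # \<alpha>s) \<alpha>) (quad_pfister \<beta>s a')"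
    unfolding left_linked_pair by auto
  define n :: nat where "n = 2 ^ length \<beta>s"
  have "0 < n" by (simp add: n_def)
  define R where "R = quad_pfister \<alpha>s \<alpha>"
  have R: "R \<in> carrier_mat n n"
    unfolding R_def using quad_pfister_carrier[of \<alpha>s \<alpha>] by (simp add: n_def length)
  define b where "b v = quad_eval (quad_pfister \<beta>s a) (spread v)" for v
  have b_add: "b (v + w) = b v + b w" if "v \<in> carrier_vec n" "w \<in> carrier_vec n" for v w
    using quad_pfister_spread[OF two, of v \<beta>s w a a] that by (simp add: b_def n_def)
  have b': "quad_eval (quad_pfister \<beta>s a') (spread v) = b v" if "v \<in> carrier_vec n" for v
    using quad_pfister_spread[OF two, of v \<beta>s v a' a] that by (simp add: b_def n_def)
  have b_unit: "b (t \<cdot>\<^sub>v unit_vec n 0) = t\<^sup>2" for t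
    using quad_eval_smult_vec[OF quad_pfister_carrier[of \<beta>s a], of "unit_vec (2 * n) 0" t]
      quad_pfister_unit_vec[of \<beta>s a] spread_unit_vec[OF \<open>0 < n\<close>, where 'a = 'a]
    by (simp add: b_def spread_smult n_def)
  obtain X Z where X: "X \<in> carrier_mat n n" and Z: "Z \<in> carrier_mat n n"
    and XZ: "\<And>v. v \<in> carrier_vec n \<Longrightarrow> quad_eval R (X *\<^sub>v v) + \<beta> * quad_eval R (Z *\<^sub>v v) = b v"
      "\<And>v w. v \<in> carrier_vec n \<Longrightarrow> w \<in> carrier_vec n \<Longrightarrow> Z *\<^sub>v v = 0\<^sub>v n \<Longrightarrow>
        polar R (X *\<^sub>v v) (X *\<^sub>v w) = 0"
    using isometric_spread_coordinates[OF two n_def length iso(1)] unfolding R_def b_def by metis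
  obtain Y Q where Y: "Y \<in> carrier_mat n n" and Q: "Q \<in> carrier_mat n n"
    and YQ: "\<And>v. v \<in> carrier_vec n \<Longrightarrow> quad_eval R (Y *\<^sub>v v) + \<gamma> * quad_eval R (Q *\<^sub>v v) = b v"
      "\<And>v w. v \<in> carrier_vec n \<Longrightarrow> w \<in> carrier_vec n \<Longrightarrow> Q *\<^sub>v v = 0\<^sub>v n \<Longrightarrow>
        polar R (Y *\<^sub>v v) (Y *\<^sub>v w) = 0"
      "\<And>v. v \<in> carrier_vec n \<Longrightarrow> Y *\<^sub>v v = 0\<^sub>v n \<Longrightarrow> Q *\<^sub>v v = 0\<^sub>v n \<Longrightarrow> v = 0\<^sub>v n"
    using isometric_spread_coordinates[OF two n_def length iso(2)] b' unfolding R_def by metis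
  define v where "v w = vec n (\<lambda>i. w $ Suc i)" for w :: "'a vec"
  define v' where "v' w = v w + w $ 0 \<cdot>\<^sub>v unit_vec n 0" for w :: "'a vec"
  have v: "v w \<in> carrier_vec n" and v': "v' w \<in> carrier_vec n" for w
    by (simp_all add: v_def v'_def)
  have v_add: "v (u + w) = v u + v w" "v' (u + w) = v' u + v' w"
    if "u \<in> carrier_vec (Suc n)" "w \<in> carrier_vec (Suc n)" for u w
    using that by (auto intro!: eq_vecI simp: v_def v'_def algebra_simps)
  have v_smult: "v (c \<cdot>\<^sub>v u) = c \<cdot>\<^sub>v v u" "v' (c \<cdot>\<^sub>v u) = c \<cdot>\<^sub>v v' u"
    if "u \<in> carrier_vec (Suc n)" for c u
    using that by (auto intro!: eq_vecI simp: v_def v'_def algebra_simps)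
  note mult_vec = mult_add_distrib_mat_vec[OF X v' v'] mult_add_distrib_mat_vec[OF Y v v]
    mult_mat_vec[OF X v'] mult_mat_vec[OF Y v]
  have carrier: "X *\<^sub>v v' w \<in> carrier_vec n" "Y *\<^sub>v v w \<in> carrier_vec n" for w
    using X Y v v' by simp_all
  obtain S where S: "S \<in> carrier_mat n (Suc n)"
    "\<And>w. w \<in> carrier_vec (Suc n) \<Longrightarrow> X *\<^sub>v v' w - Y *\<^sub>v v w = S *\<^sub>v w"
  proof (rule linear_map_matrix[of "Suc n" "\<lambda>w. X *\<^sub>v v' w - Y *\<^sub>v v w" n])
    show "X *\<^sub>v v' w - Y *\<^sub>v v w \<in> carrier_vec n" for w
      using carrier by simp
    show "X *\<^sub>v v' (u + w) - Y *\<^sub>v v (u + w) = (X *\<^sub>v v' u - Y *\<^sub>v v u) + (X *\<^sub>v v' w - Y *\<^sub>v v w)"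
      if "u \<in> carrier_vec (Suc n)" "w \<in> carrier_vec (Suc n)" for u w
      using X Y v v' unfolding v_add[OF that] mult_vec
      by (intro eq_vecI) (simp_all del: index_mult_mat_vec)
    show "X *\<^sub>v v' (c \<cdot>\<^sub>v u) - Y *\<^sub>v v (c \<cdot>\<^sub>v u) = c \<cdot>\<^sub>v (X *\<^sub>v v' u - Y *\<^sub>v v u)"
      if "u \<in> carrier_vec (Suc n)" for c u
      using X Y v v' unfolding v_smult[OF that] mult_vec
      by (intro eq_vecI) (simp_all del: index_mult_mat_vec add: algebra_simps)
  qed blast
  \<comment> \<open>The matrix of the polar form: it expresses polarity as a dot product, as
    \<open>kernel_pairing\<close> requires.\<close>
  define B where "B = R\<^sup>T + R"
  have B: "B \<in> carrier_mat n n" using R by (simp add: B_def)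
  have polar_B: "polar R x y = (B *\<^sub>v x) \<bullet> y" if "x \<in> carrier_vec n" "y \<in> carrier_vec n" for x y
    using polar_eq_scalar_prod[OF R that] R that
    by (simp add: B_def add_mult_distrib_mat_vec[of _ n n])
  obtain T where T: "T \<in> carrier_mat n (Suc n)"
    "\<And>w. w \<in> carrier_vec (Suc n) \<Longrightarrow> B *\<^sub>v (Y *\<^sub>v v w) = T *\<^sub>v w"
  proof (rule linear_map_matrix[of "Suc n" "\<lambda>w. B *\<^sub>v (Y *\<^sub>v v w)" n])
    show "B *\<^sub>v (Y *\<^sub>v v w) \<in> carrier_vec n" for w
      using B carrier by simp
    show "B *\<^sub>v (Y *\<^sub>v v (u + w)) = B *\<^sub>v (Y *\<^sub>v v u) + B *\<^sub>v (Y *\<^sub>v v w)"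
      if "u \<in> carrier_vec (Suc n)" "w \<in> carrier_vec (Suc n)" for u w
      unfolding v_add[OF that] mult_vec by (rule mult_add_distrib_mat_vec[OF B carrier(2) carrier(2)])
    show "B *\<^sub>v (Y *\<^sub>v v (c \<cdot>\<^sub>v u)) = c \<cdot>\<^sub>v (B *\<^sub>v (Y *\<^sub>v v u))"
      if "u \<in> carrier_vec (Suc n)" for c u
      unfolding v_smult[OF that] mult_vec by (rule mult_mat_vec[OF B carrier(2)])
  qed blast
  have kernel: "w $ 0 = 0 \<and> v' w = v w \<and> X *\<^sub>v v w = Y *\<^sub>v v w \<and> Z *\<^sub>v v w = 0\<^sub>v n \<and> Q *\<^sub>v v w = 0\<^sub>v n"
    if w: "w \<in> carrier_vec (Suc n)" and Sw: "S *\<^sub>v w = 0\<^sub>v n" for w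
  proof -
    have XY: "X *\<^sub>v v' w = Y *\<^sub>v v w"
    proof (rule eq_vecI)
      fix i assume i: "i < dim_vec (Y *\<^sub>v v w)"
      have "(X *\<^sub>v v' w - Y *\<^sub>v v w) $ i = 0" using S(2)[OF w] Sw i Y by simp
      then show "(X *\<^sub>v v' w) $ i = (Y *\<^sub>v v w) $ i" using i X Y by (simp del: index_mult_mat_vec)
    qed (use X Y in simp)
    let ?r = "quad_eval R (Y *\<^sub>v v w)"
    have b_v': "b (v' w) = b (v w) + (w $ 0)\<^sup>2"
      unfolding v'_def using v by (subst b_add) (auto simp: b_unit)
    have "?r + \<beta> * quad_eval R (Z *\<^sub>v v' w) = b (v w) + (w $ 0)\<^sup>2"
      "?r + \<gamma> * quad_eval R (Q *\<^sub>v v w) = b (v w)"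
      using XZ(1)[OF v', of w] YQ(1)[OF v, of w] XY b_v' by simp_all
    \<comment> \<open>On adding the two equations, the common value of \<rho> and the value b(v, v)
      each occur twice and cancel.\<close>
    then have "(?r + \<beta> * quad_eval R (Z *\<^sub>v v' w)) + (?r + \<gamma> * quad_eval R (Q *\<^sub>v v w)) =
        (b (v w) + (w $ 0)\<^sup>2) + b (v w)"
      by (rule arg_cong2[where f = "(+)"])
    then have "2 * ?r + (\<beta> * quad_eval R (Z *\<^sub>v v' w) + \<gamma> * quad_eval R (Q *\<^sub>v v w)) =
        2 * b (v w) + (w $ 0)\<^sup>2"
      by (simp add: algebra_simps)
    then have "(w $ 0)\<^sup>2 = \<beta> * quad_eval R (Z *\<^sub>v v' w) + \<gamma> * quad_eval R (Q *\<^sub>v v w)"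
      by (simp add: char2_mult_2[OF two])
    moreover have "dim_row R = n" "Z *\<^sub>v v' w \<in> carrier_vec n" "Q *\<^sub>v v w \<in> carrier_vec n"
      using R Z Q v v' by simp_all
    \<comment> \<open>As no nontrivial relation exists, every entry of this one is zero; in
      particular the shift by t e_0 disappears.\<close>
    ultimately have "w $ 0 = 0" "Z *\<^sub>v v' w = 0\<^sub>v n" "Q *\<^sub>v v w = 0\<^sub>v n"
      using no_rel unfolding square_relation_def R_def[symmetric] by metis+
    moreover from \<open>w $ 0 = 0\<close> have "v' w = v w"
      unfolding v'_def using v[of w] by (intro eq_vecI) auto
    ultimately show ?thesis using XY by simp
  qed
  obtain w where w: "w \<in> carrier_vec (Suc n)" "w \<noteq> 0\<^sub>v (Suc n)" "S *\<^sub>v w = 0\<^sub>v n" "T *\<^sub>v w = 0\<^sub>v n"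
  proof (rule kernel_pairing[OF S(1) T(1)])
    fix w w' :: "'a vec"
    assume w: "w \<in> carrier_vec (Suc n)" "w' \<in> carrier_vec (Suc n)" "S *\<^sub>v w = 0\<^sub>v n"
    note k = kernel[OF w(1,3)]
    \<comment> \<open>On the kernel, X v = Y v with Z v = 0 and Q v = 0. So this vector is
      orthogonal to the image of X by the first decomposition and to that of Y by the second, hence
      to the image of S.\<close>
    have "polar R (Y *\<^sub>v v w) (X *\<^sub>v v' w') = 0"
      using XZ(2)[OF v v', of w w'] k by simp
    moreover have "polar R (Y *\<^sub>v v w) (Y *\<^sub>v v w') = 0"
      using YQ(2)[OF v v, of w w'] k by simp
    ultimately have "(B *\<^sub>v (Y *\<^sub>v v w)) \<bullet> (X *\<^sub>v v' w' - Y *\<^sub>v v w') = 0"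
      using B carrier by (simp add: polar_B scalar_prod_minus_distrib[of _ n])
    then show "(T *\<^sub>v w) \<bullet> (S *\<^sub>v w') = 0"
      using S(2)[OF w(2)] T(2)[OF w(1)] by simp
  qed auto
  note k = kernel[OF w(1,3)]
  have "B *\<^sub>v (Y *\<^sub>v v w) = 0\<^sub>v n" using T(2)[OF w(1)] w(4) by simp
  then have "polar R (Y *\<^sub>v v w) y = 0" if "y \<in> carrier_vec n" for y
    using polar_B[OF carrier(2) that] that by simp
  \<comment> \<open>Now both components of v \<otimes> e_1 in the second decomposition vanish, so v
    = 0, against the choice of w.\<close>
  then have "Y *\<^sub>v v w = 0\<^sub>v n"
    using quad_pfister_nondegenerate[OF two \<alpha>s, of "Y *\<^sub>v v w" \<alpha>] carrier(2)[of w]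
    by (simp add: R_def n_def length)
  with k have "v w = 0\<^sub>v n" using YQ(3)[OF v] by blast
  have "w $ i = 0" if "i < Suc n" for i
  proof (cases i)
    case (Suc j)
    then show ?thesis
      using arg_cong[OF \<open>v w = 0\<^sub>v n\<close>, of "\<lambda>u. u $ j"] that by (simp add: v_def)
  qed (use k in simp)
  then have "w = 0\<^sub>v (Suc n)" using w(1) by (intro eq_vecI) auto
  with w(2) show False by simp
qed

theorem theorem5p3:
  fixes \<beta> \<gamma> \<alpha> :: "'a :: field" and \<alpha>s :: "'a list" and n :: nat
  assumes "CHAR('a) = 2" and "n \<ge> 2"
    and "\<beta> \<noteq> 0" and "\<gamma> \<noteq> 0"
    and "length \<alpha>s = n - 2" and "0 \<notin> set \<alpha>s"
  shows "left_linked n {quad_pfister (\<beta> # \<alpha>s) \<alpha>, quad_pfister (\<gamma> # \<alpha>s) \<alpha>}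
     \<longleftrightarrow> hyperbolic (quad_pfister (\<gamma> # \<beta> # \<alpha>s) \<alpha>)"
proof -
  have n: "n = length \<alpha>s + 2" using assms by simp
  show ?thesis
    unfolding n
    using left_linked_imp_square_relation[OF assms(1,6)] square_relation_imp_left_linked[OF assms(1,3,4,6)]
      square_relation_imp_hyperbolic[OF assms(1,3,4,6)] hyperbolic_imp_square_relation[OF assms(1)]
    by blast
qed

end
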